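(* Let $n\ge 3$ and consider the ordinary differential equation $$y^{(n)}=\omega\left(x,y,y',\dots,y^{(n-1)}\right).$$ Let $\mathcal{L}$ be the (finite-dimensional) Lie algebra of infinitesimal generators of one-parameter local Lie groups of contact symmetries of this equation, with basis $$X_i=\xi_i(x,y,y')\,\partial_x+\eta_i(x,y,y')\,\partial_y+\eta_i^{(1)}(x,y,y')\,\partial_{y'},\qquad i=1,\dots,N,$$ and structure constants $c_{ij}^k$ defined by $[X_i,X_j]=\sum_{k=1}^N c_{ij}^kX_k$. Let $$\Gamma:(x,y,y')\mapsto\left(\hat x(x,y,y'),\hat y(x,y,y'),\hat y'(x,y,y')\right)$$ be any contact symmetry of the equation, and let $\hat X_i$ denote the vector field obtained from $X_i$ by replacing $(x,y,y')$ by $(\hat x,\hat y,\hat y')$, i.e. $$\hat X_i=\xi_i(\hat x,\hat y,\hat y')\,\partial_{\hat x}+\eta_i(\hat x,\hat y,\hat y')\,\partial_{\hat y}+\eta_i^{(1)}(\hat x,\hat y,\hat y')\,\partial_{\hat y'},\qquad i=1,\dots,N.$$ Then $\hat X_i\in\mathcal{L}$ for every $i$, and the linear map determined by $X_i\mapsto\hat X_i$ is an automorphism of the Lie algebra $\mathcal{L}$. There exists a constant non-singular $N\times N$ matrix $\left(b_i^l\right)$ such that $$X_i=\sum_{l=1}^N b_i^l\hat X_l,\qquad i=1,\dots,N,$$ and the automorphism preserves all structure constants: $$[\hat X_i,\hat X_j]=\sum_{k=1}^N c_{ij}^k\hat X_k,\qquad i,j=1,\dots,N.$$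
   Context: All functions are smooth. The function $\omega$ is defined on an open set of the space with coordinates $(x,y,y',\dots,y^{(n-1)})$, and $M$ denotes the corresponding open set of points $(x,y,y')$ (the projection of the domain of $\omega$). Write $D=\partial_x+y'\partial_y+y''\partial_{y'}+\cdots$ for the total derivative operator. Contact symmetry. A contact transformation is a diffeomorphism $\Gamma:M\to M$, $(x,y,y')\mapsto(\hat x,\hat y,\hat y')$, whose components are functions of $(x,y,y')$ satisfying the contact condition $\hat y'=D\hat y/D\hat x$, i.e. $$\hat y_x+y'\hat y_y=(\hat x_x+y'\hat x_y)\,\hat y',\qquad \hat y_{y'}=\hat x_{y'}\,\hat y'.$$ It is prolonged to higher derivatives, wherever $D\hat x\neq0$, by $\hat y^{(k)}=D\hat y^{(k-1)}/D\hat x$ with $\hat y^{(0)}=\hat y$. It is a contact symmetry of the equation $y^{(n)}=\omega$ if it maps the set of solutions to itself, i.e. if $\hat y^{(n)}=\omega(\hat x,\hat y,\hat y',\dots,\hat y^{(n-1)})$ whenever $y^{(n)}=\omega(x,y,y',\dots,y^{(n-1)})$. This is understood as follows: $D\hat x\ne 0$ on a dense open subset of the set of points $(x,y,\dots,y^{(n)})$ satisfying the equation, and at all such points $(\hat x,\hat y,\dots,\hat y^{(n-1)})$ lies in the domain of $\omega$ and the transformed equation holds. Generators of Lie contact symmetries. $\mathcal{L}$ is the set of vector fields $X=\xi\partial_x+\eta\partial_y+\eta^{(1)}\partial_{y'}$ on $M$ for which there is a characteristic function $Q(x,y,y')$ with $$\xi=-Q_{y'},\qquad \eta=Q-y'Q_{y'},\qquad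 \eta^{(1)}=Q_x+y'Q_y,$$ and which satisfy the linearized symmetry condition: with $\eta^{(k)}=D^kQ-y^{(k+1)}Q_{y'}$ for $k\ge1$ and $\eta^{(0)}=\eta$, one has $$\eta^{(n)}=\xi\,\omega_x+\sum_{k=0}^{n-1}\eta^{(k)}\,\frac{\partial\omega}{\partial y^{(k)}}\qquad\text{whenever } y^{(n)}=\omega .$$ Standing assumption: for the given equation of order $n\ge3$, $\mathcal{L}$ is a finite-dimensional Lie algebra under the commutator of vector fields, $N=\dim\mathcal{L}\geq 1$. The vector field $\hat X_i$. The functions $(\hat x,\hat y,\hat y')$ are used as coordinates on $M$ and $\partial_{\hat x},\partial_{\hat y},\partial_{\hat y'}$ are the associated coordinate vector fields. Thus $\hat X_i$ is the unique vector field on $M$ with $\hat X_i\hat x=\xi_i(\hat x,\hat y,\hat y')$, $\hat X_i\hat y=\eta_i(\hat x,\hat y,\hat y')$, $\hat X_i\hat y'=\eta^{(1)}_i(\hat x,\hat y,\hat y')$, i.e. the pull-back $\Gamma^*X_i$ (in the paper's operator notation, $\hat X_i=\Gamma X_i\Gamma^{-1}$). *)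

theory Defs
  imports "HOL-Analysis.Analysis" "HOL-Library.Function_Algebras"
begin

instantiation "fun" :: (type, real_vector) real_vector
begin

definition scaleR_fun :: "real \<Rightarrow> ('a \<Rightarrow> 'b) \<Rightarrow> 'a \<Rightarrow> 'b"
  where "scaleR_fun c f = (\<lambda>x. c *\<^sub>R f x)"

instance
  by standard (auto simp: scaleR_fun_def plus_fun_def scaleR_add_right scaleR_add_left)

end

text \<open>
  The space $J^k$ with coordinates $(x, y, y', \dots, y^{(k)})$ is \<^term>\<open>Euclidean_space (k + 2)\<close>:
  coordinate 0 of a point is $x$, coordinate $i + 1$ is $y^{(i)}$, all later coordinates vanish.
  In particular $(x, y, y')$ are the coordinates 0, 1, 2 on $J^1$ = \<^term>\<open>Euclidean_space 3\<close>.
\<close>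

type_synonym point = "nat \<Rightarrow> real"

definition jet_proj :: "nat \<Rightarrow> point \<Rightarrow> point"
  where "jet_proj k p = (\<lambda>i. if i \<le> k + 1 then p i else 0)"

definition partial :: "nat \<Rightarrow> (point \<Rightarrow> real) \<Rightarrow> point \<Rightarrow> real"
  where "partial i f p = deriv (\<lambda>t. f (p(i := t))) (p i)"

text \<open>Meant for \<open>U\<close> open in \<^term>\<open>Euclidean_space m\<close>: all iterated partial derivatives
  of \<open>f\<close> exist and are continuous on \<open>U\<close>.\<close>

definition smooth_fun_on :: "nat \<Rightarrow> point set \<Rightarrow> (point \<Rightarrow> real) \<Rightarrow> bool"
  where "smooth_fun_on m U f \<longleftrightarrow>
    (\<forall>is \<in> lists {..<m}.
       continuous_on U (foldr partial is f) \<and>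
       (\<forall>p\<in>U. \<forall>i<m. (\<lambda>t. foldr partial is f (p(i := t))) differentiable (at (p i))))"

text \<open>The total derivative of a function on $J^k$, as a function on $J^{k+1}$.  It depends only on
  the coordinates up to $y^{(k+1)}$, so it may also be evaluated on higher jets.\<close>

definition total_deriv :: "nat \<Rightarrow> (point \<Rightarrow> real) \<Rightarrow> point \<Rightarrow> real"
  where "total_deriv k f p =
    partial 0 f (jet_proj k p) + (\<Sum>i=1..k+1. p (i + 1) * partial i f (jet_proj k p))"

definition base_domain :: "point set \<Rightarrow> point set"
  where "base_domain \<Omega> = jet_proj 1 ` \<Omega>"

text \<open>The points of $J^n$ with $y^{(n)} = \omega$.\<close>

definition equation_set :: "nat \<Rightarrow> point set \<Rightarrow> (point \<Rightarrow> real) \<Rightarrow> point set"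
  where "equation_set n \<Omega> \<omega> =
    {p \<in> topspace (Euclidean_space (n + 2)).
       jet_proj (n - 1) p \<in> \<Omega> \<and> p (n + 1) = \<omega> (jet_proj (n - 1) p)}"


subsection \<open>Vector fields\<close>

text \<open>A vector field on \<open>M\<close> is given by its components with respect to
  $\partial_x, \partial_y, \partial_{y'}$, extended by 0 outside \<open>M\<close>, so that equality of
  functions is equality of vector fields on \<open>M\<close>.\<close>

definition vector_field_on :: "point set \<Rightarrow> (point \<Rightarrow> point) \<Rightarrow> bool"
  where "vector_field_on M X \<longleftrightarrow>
    (\<forall>p. p \<notin> M \<longrightarrow> X p = 0) \<and> (\<forall>p\<in>M. \<forall>i\<ge>3. X p i = 0) \<and>
    (\<forall>i<3. smooth_fun_on 3 M (\<lambda>p. X p i))"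

definition vf_apply :: "(point \<Rightarrow> point) \<Rightarrow> (point \<Rightarrow> real) \<Rightarrow> point \<Rightarrow> real"
  where "vf_apply X f p = (\<Sum>j<3. X p j * partial j f p)"

definition commutator :: "(point \<Rightarrow> point) \<Rightarrow> (point \<Rightarrow> point) \<Rightarrow> point \<Rightarrow> point"
  where "commutator X Y =
    (\<lambda>p i. vf_apply X (\<lambda>q. Y q i) p - vf_apply Y (\<lambda>q. X q i) p)"

definition vf_lie_algebra :: "(point \<Rightarrow> point) set \<Rightarrow> bool"
  where "vf_lie_algebra L \<longleftrightarrow> subspace L \<and> (\<forall>X\<in>L. \<forall>Y\<in>L. commutator X Y \<in> L)"

definition vf_lie_automorphism ::
    "(point \<Rightarrow> point) set \<Rightarrow> ((point \<Rightarrow> point) \<Rightarrow> (point \<Rightarrow> point)) \<Rightarrow> bool"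
  where "vf_lie_automorphism L \<phi> \<longleftrightarrow>
    bij_betw \<phi> L L \<and>
    (\<forall>X\<in>L. \<forall>Y\<in>L. \<phi> (X + Y) = \<phi> X + \<phi> Y) \<and>
    (\<forall>c. \<forall>X\<in>L. \<phi> (c *\<^sub>R X) = c *\<^sub>R \<phi> X) \<and>
    (\<forall>X\<in>L. \<forall>Y\<in>L. \<phi> (commutator X Y) = commutator (\<phi> X) (\<phi> Y))"


subsection \<open>Contact transformations and contact symmetries\<close>

definition diffeo_on :: "point set \<Rightarrow> (point \<Rightarrow> point) \<Rightarrow> bool"
  where "diffeo_on M \<Gamma> \<longleftrightarrow>
    bij_betw \<Gamma> M M \<and>
    (\<forall>i<3. smooth_fun_on 3 M (\<lambda>p. \<Gamma> p i)) \<and>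
    (\<forall>i<3. smooth_fun_on 3 M (\<lambda>p. inv_into M \<Gamma> p i))"

text \<open>The components 0, 1, 2 of \<open>\<Gamma>\<close> are $\hat x, \hat y, \hat y'$.\<close>

definition contact_transformation :: "point set \<Rightarrow> (point \<Rightarrow> point) \<Rightarrow> bool"
  where "contact_transformation M \<Gamma> \<longleftrightarrow>
    diffeo_on M \<Gamma> \<and>
    (let xh = (\<lambda>p. \<Gamma> p 0); yh = (\<lambda>p. \<Gamma> p 1); yh' = (\<lambda>p. \<Gamma> p 2) in
      \<forall>p\<in>M. partial 0 yh p + p 2 * partial 1 yh p
                = (partial 0 xh p + p 2 * partial 1 xh p) * yh' p \<and>
              partial 2 yh p = partial 2 xh p * yh' p)"

abbreviation D_xhat :: "(point \<Rightarrow> point) \<Rightarrow> point \<Rightarrow> real"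
  where "D_xhat \<Gamma> \<equiv> total_deriv 1 (\<lambda>q. \<Gamma> q 0)"

text \<open>$\hat y^{(k)}$ as a function of $(x, y, \dots, y^{(k)})$, evaluated on jets of order at
  least $k$.  For $k = 1$ the recursion $\hat y^{(k)} = D\hat y^{(k-1)} / D\hat x$ is the contact
  condition, so $\hat y'$ is taken from \<open>\<Gamma>\<close>.\<close>

fun yhat :: "(point \<Rightarrow> point) \<Rightarrow> nat \<Rightarrow> point \<Rightarrow> real" where
  "yhat \<Gamma> 0 p = \<Gamma> (jet_proj 1 p) 1"
| "yhat \<Gamma> (Suc 0) p = \<Gamma> (jet_proj 1 p) 2"
| "yhat \<Gamma> (Suc (Suc k)) p = total_deriv (Suc k) (yhat \<Gamma> (Suc k)) p / D_xhat \<Gamma> p"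

text \<open>$(\hat x, \hat y, \dots, \hat y^{(k)})$\<close>

definition prolong :: "(point \<Rightarrow> point) \<Rightarrow> nat \<Rightarrow> point \<Rightarrow> point"
  where "prolong \<Gamma> k p =
    (\<lambda>i. if i \<le> k + 1
          then (case i of 0 \<Rightarrow> \<Gamma> (jet_proj 1 p) 0 | Suc m \<Rightarrow> yhat \<Gamma> m p)
          else 0)"

definition contact_symmetry ::
    "nat \<Rightarrow> point set \<Rightarrow> (point \<Rightarrow> real) \<Rightarrow> (point \<Rightarrow> point) \<Rightarrow> bool"
  where "contact_symmetry n \<Omega> \<omega> \<Gamma> \<longleftrightarrow>
    contact_transformation (base_domain \<Omega>) \<Gamma> \<and>
    (let E = equation_set n \<Omega> \<omega>; S = {p \<in> E. D_xhat \<Gamma> p \<noteq> 0} in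
      openin (top_of_set E) S \<and> E \<subseteq> closure S \<and>
      (\<forall>p\<in>S. prolong \<Gamma> (n - 1) p \<in> \<Omega> \<and> yhat \<Gamma> n p = \<omega> (prolong \<Gamma> (n - 1) p)))"

text \<open>\<open>\<Gamma>\<^sup>*X\<close>, i.e. the vector field with components those of \<open>X\<close> at $(\hat x, \hat y, \hat y')$
  with respect to $\partial_{\hat x}, \partial_{\hat y}, \partial_{\hat y'}$.\<close>

definition pullback_vf :: "point set \<Rightarrow> (point \<Rightarrow> point) \<Rightarrow> (point \<Rightarrow> point) \<Rightarrow> point \<Rightarrow> point"
  where "pullback_vf M \<Gamma> X =
    (THE Z. vector_field_on M Z \<and>
            (\<forall>p\<in>M. \<forall>i<3. vf_apply Z (\<lambda>q. \<Gamma> q i) p = X (\<Gamma> p) i))"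


subsection \<open>Generators of Lie contact symmetries\<close>

text \<open>$D^k Q$, a function on $J^{k+1}$\<close>

fun total_deriv_pow :: "nat \<Rightarrow> (point \<Rightarrow> real) \<Rightarrow> point \<Rightarrow> real" where
  "total_deriv_pow 0 Q p = Q (jet_proj 1 p)"
| "total_deriv_pow (Suc k) Q p = total_deriv (Suc k) (total_deriv_pow k Q) p"

text \<open>$\eta^{(k)} = D^k Q - y^{(k+1)} Q_{y'}$; for $k = 0$ this is $\eta = Q - y' Q_{y'}$.\<close>

definition eta_k :: "(point \<Rightarrow> real) \<Rightarrow> nat \<Rightarrow> point \<Rightarrow> real"
  where "eta_k Q k p = total_deriv_pow k Q p - p (k + 2) * partial 2 Q (jet_proj 1 p)"

text \<open>The points \<open>p\<close> range over $J^{n+1}$ because the two terms of $\eta^{(n)}$ are separately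
  functions on $J^{n+1}$; $y^{(n+1)}$ cancels in their difference.\<close>

definition linearized_symmetry_condition ::
    "nat \<Rightarrow> point set \<Rightarrow> (point \<Rightarrow> real) \<Rightarrow> (point \<Rightarrow> point) \<Rightarrow> (point \<Rightarrow> real) \<Rightarrow> bool"
  where "linearized_symmetry_condition n \<Omega> \<omega> X Q \<longleftrightarrow>
    (\<forall>p \<in> topspace (Euclidean_space (n + 3)).
       jet_proj n p \<in> equation_set n \<Omega> \<omega> \<longrightarrow>
       eta_k Q n p =
         X (jet_proj 1 p) 0 * partial 0 \<omega> (jet_proj (n - 1) p) +
         (\<Sum>k<n. eta_k Q k p * partial (k + 1) \<omega> (jet_proj (n - 1) p)))"

definition contact_generators ::
    "nat \<Rightarrow> point set \<Rightarrow> (point \<Rightarrow> real) \<Rightarrow> (point \<Rightarrow> point) set"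
  where "contact_generators n \<Omega> \<omega> =
    {X. vector_field_on (base_domain \<Omega>) X \<and>
        (\<exists>Q. smooth_fun_on 3 (base_domain \<Omega>) Q \<and>
             (\<forall>p\<in>base_domain \<Omega>.
                X p 0 = - partial 2 Q p \<and>
                X p 1 = Q p - p 2 * partial 2 Q p \<and>
                X p 2 = partial 0 Q p + p 2 * partial 1 Q p) \<and>
             linearized_symmetry_condition n \<Omega> \<omega> X Q)}"

end

theory Submission
  imports Defs
begin

text \<open>
  Write $\theta = dy - y'\,dx$ for the contact form.  A contact transformation satisfies
  $\Gamma^*\theta = \lambda\theta$ with $\lambda\ne0$.  A vector field on $J^1$ with characteristic \<open>Q\<close> is one
  with $\theta(X) = Q$ that preserves $\theta$ up to a factor; contracting $\Gamma^*\theta = \lambda\theta$ and its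
  exterior derivative with $\hat X = \Gamma^*X$ shows that $\hat X$ is again of this form, with
  characteristic $\hat Q = (Q\circ\Gamma)/\lambda$ (lemma \<open>contact_characteristic_pullback\<close>).

  Prolongation to jets of higher order is natural.  On the jets with $D\hat x\ne0$ the prolonged
  transformation \<open>\<Phi>\<close> satisfies $D(f\circ\Phi) = D\hat x\cdot(Df)\circ\Phi$, and a prolonged contact field
  $v$ satisfies $[v, D] = -(D\xi)D$.  The two rules propagate the relation
  $\hat v\,\hat y^{(k)} = \eta^{(k)}\circ\Phi$ from order $k$ to order $k+1$: the prolongation $\hat v$ of
  $\hat X$ is \<open>\<Phi>\<close>-related to the prolongation of $X$ (lemma \<open>prolonged_vf_\<Phi>\<close>).

  The linearized symmetry condition says that the prolonged field is tangent to the equation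
  $y^{(n)} = \omega$.  Let $F = \hat y^{(n)} - \omega(\hat x,\dots,\hat y^{(n-1)})$.  As \<open>\<Gamma>\<close> is a symmetry, $F$ vanishes
  on the equation; by \<open>\<Phi>\<close>-relatedness and tangency of $X$, $\hat vF = 0$ there.  The derivative
  $\partial F/\partial y^{(n)}$ does not vanish, because $d\hat x$ and $d\hat y'$ are independent on the contact
  planes.  Hence the equation is locally the regular zero set of $F$ and $\hat v$ is tangent to it.  This holds
  where $D\hat x\ne0$, which is a dense part of the equation, hence everywhere by continuity (lemma
  \<open>pullback_linearized\<close>).

  So $X\mapsto\Gamma^*X$ maps $\mathcal{L}$ to itself.  It is linear and injective, respects brackets because
  $\Gamma^*X$ and $X$ are \<open>\<Gamma>\<close>-related, and is onto because $\mathcal{L}$ has finite dimension.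

  Points of jet spaces are sequences of reals, so the calculus needed here (chain rule, closure properties of
  smooth functions, symmetry of second derivatives) is developed from partial derivatives alone.
\<close>

section \<open>Differential calculus on open subsets of the coordinate spaces\<close>

lemma Euclidean_space_open_box:
  assumes "openin (Euclidean_space m) U" "p \<in> U"
  obtains e where "e > 0"
    "\<And>q. (\<And>i. i \<ge> m \<Longrightarrow> q i = 0) \<Longrightarrow> (\<And>i. i < m \<Longrightarrow> \<bar>q i - p i\<bar> < e) \<Longrightarrow> q \<in> U"
proof -
  obtain T where T: "open T" "U = T \<inter> {x. \<forall>i\<ge>m. x i = 0}"
    using assms(1) unfolding Euclidean_space_def euclidean_product_topology openin_subtopology
    by auto
  have "openin (product_topology (\<lambda>i. euclidean) UNIV) T" "p \<in> T"
    using T assms(2) unfolding open_fun_def by auto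
  from product_topology_open_contains_basis[OF this]
  obtain X where X: "p \<in> (\<Pi>\<^sub>E i\<in>UNIV. X i)" "\<And>i. open (X i)" "(\<Pi>\<^sub>E i\<in>UNIV. X i) \<subseteq> T"
    by auto
  have "\<exists>e>0. \<forall>y. \<bar>y - p i\<bar> < e \<longrightarrow> y \<in> X i" for i
    using X(1) X(2)[of i] unfolding open_real_def[symmetric] open_dist dist_real_def by auto
  then obtain e where e: "\<And>i. e i > 0" "\<And>i y. \<bar>y - p i\<bar> < e i \<Longrightarrow> y \<in> X i"
    by metis
  define d where "d = Min (insert 1 (e ` {..<m}))"
  have d: "d > 0" "\<And>i. i < m \<Longrightarrow> d \<le> e i"
    using e(1) by (auto simp: d_def)
  show thesis
  proof (rule that[OF d(1)])
    fix q assume q: "\<And>i. i \<ge> m \<Longrightarrow> q i = 0" "\<And>i. i < m \<Longrightarrow> \<bar>q i - p i\<bar> < d"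
    have p0: "p i = 0" if "i \<ge> m" for i using that T assms(2) by auto
    have "q i \<in> X i" for i
    proof (cases "i < m")
      case True
      then show ?thesis using q(2) d(2) e(2) by (meson less_le_trans)
    next
      case False
      then have "q i = p i" using q(1) p0 by auto
      then show ?thesis using e by simp
    qed
    then show "q \<in> U" using X(3) T(2) q(1) by auto
  qed
qed

lemma smooth_fun_on_unfold:
  "smooth_fun_on m U f \<longleftrightarrow> continuous_on U f \<and>
    (\<forall>p\<in>U. \<forall>i<m. (\<lambda>t. f (p(i := t))) differentiable (at (p i))) \<and>
    (\<forall>i<m. smooth_fun_on m U (partial i f))" (is "?L \<longleftrightarrow> ?R")
proof
  assume L: ?L
  have "smooth_fun_on m U (partial i f)" if "i < m" for i
    unfolding smooth_fun_on_def
  proof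
    fix "is" assume "is \<in> lists {..<m}"
    then have "is @ [i] \<in> lists {..<m}" using that by auto
    from bspec[OF L[unfolded smooth_fun_on_def] this]
    show "continuous_on U (foldr partial is (partial i f)) \<and>
       (\<forall>p\<in>U. \<forall>ia<m. (\<lambda>t. foldr partial is (partial i f) (p(ia := t))) differentiable at (p ia))"
      by simp
  qed
  moreover have "continuous_on U f \<and> (\<forall>p\<in>U. \<forall>i<m. (\<lambda>t. f (p(i := t))) differentiable (at (p i)))"
    using bspec[OF L[unfolded smooth_fun_on_def] lists.Nil] by simp
  ultimately show ?R by blast
next
  assume R: ?R
  show ?L unfolding smooth_fun_on_def
  proof
    fix "is" assume is_in: "is \<in> lists {..<m}"
    show "continuous_on U (foldr partial is f) \<and>
       (\<forall>p\<in>U. \<forall>i<m. (\<lambda>t. foldr partial is f (p(i := t))) differentiable at (p i))"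
    proof (cases "is" rule: rev_cases)
      case Nil
      then show ?thesis using R by simp
    next
      case (snoc js i)
      then have "i < m" "js \<in> lists {..<m}" using is_in by auto
      then show ?thesis using R snoc unfolding smooth_fun_on_def by simp
    qed
  qed
qed

text \<open>\<open>C\<^sup>k\<close>-regularity, with the derivatives prescribed only on \<open>U\<close>: unlike iterates of
  \<^const>\<open>partial\<close> this allows the derivative of a product to be replaced by the expression of
  the product rule, so that closure properties can be proved by induction on \<open>k\<close>.\<close>

primrec cdiff_on :: "nat \<Rightarrow> nat \<Rightarrow> point set \<Rightarrow> (point \<Rightarrow> real) \<Rightarrow> bool" where
  "cdiff_on 0 m U f \<longleftrightarrow> continuous_on U f"
| "cdiff_on (Suc k) m U f \<longleftrightarrow> continuous_on U f \<and>
     (\<forall>i<m. \<exists>g. cdiff_on k m U g \<and>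
        (\<forall>p\<in>U. ((\<lambda>t. f (p(i := t))) has_real_derivative g p) (at (p i))))"

lemma cdiff_on_mono: "cdiff_on (Suc k) m U f \<Longrightarrow> cdiff_on k m U f"
proof (induction k arbitrary: f)
  case (Suc k)
  have "\<exists>g. cdiff_on k m U g \<and> (\<forall>p\<in>U. ((\<lambda>t. f (p(i := t))) has_real_derivative g p) (at (p i)))"
    if "i < m" for i
    using Suc that by (metis cdiff_on.simps(2))
  moreover have "continuous_on U f" using Suc.prems by simp
  ultimately show ?case by simp
qed simp

lemma smooth_fun_on_continuous: "smooth_fun_on m U f \<Longrightarrow> continuous_on U f"
  using smooth_fun_on_unfold by blast

lemma smooth_fun_on_partial: "smooth_fun_on m U f \<Longrightarrow> i < m \<Longrightarrow> smooth_fun_on m U (partial i f)"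
  using smooth_fun_on_unfold by blast

lemma smooth_fun_on_has_partial:
  assumes "smooth_fun_on m U f" "p \<in> U" "i < m"
  shows "((\<lambda>t. f (p(i := t))) has_real_derivative partial i f p) (at (p i))"
proof -
  have "(\<lambda>t. f (p(i := t))) differentiable (at (p i))"
    using assms smooth_fun_on_unfold by blast
  then show ?thesis unfolding partial_def
    by (metis DERIV_deriv_iff_real_differentiable)
qed

lemma smooth_fun_on_imp_cdiff_on: "smooth_fun_on m U f \<Longrightarrow> cdiff_on k m U f"
proof (induction k arbitrary: f)
  case (Suc k)
  show ?case unfolding cdiff_on.simps
  proof (intro conjI allI impI smooth_fun_on_continuous[OF Suc.prems])
    fix i assume "i < m"
    with Suc show "\<exists>g. cdiff_on k m U g \<and>
        (\<forall>p\<in>U. ((\<lambda>t. f (p(i := t))) has_real_derivative g p) (at (p i)))"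
      by (intro exI[of _ "partial i f"]) (auto intro: smooth_fun_on_partial smooth_fun_on_has_partial)
  qed
qed (simp add: smooth_fun_on_continuous)

locale coordinate_domain =
  fixes m :: nat and U :: "point set"
  assumes open_dom: "openin (Euclidean_space m) U"
begin

lemma dom_beyond: "p \<in> U \<Longrightarrow> i \<ge> m \<Longrightarrow> p i = 0"
  using openin_subset[OF open_dom] by (auto simp: topspace_Euclidean_space)

lemma eventually_line:
  assumes "p \<in> U" "i < m"
  shows "\<forall>\<^sub>F t in nhds (p i). p(i := t) \<in> U"
proof -
  obtain e where e: "e > 0"
    "\<And>q. (\<And>i. i \<ge> m \<Longrightarrow> q i = 0) \<Longrightarrow> (\<And>i. i < m \<Longrightarrow> \<bar>q i - p i\<bar> < e) \<Longrightarrow> q \<in> U"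
    using Euclidean_space_open_box[OF open_dom assms(1)] by blast
  have "p(i := t) \<in> U" if "dist t (p i) < e" for t
    by (rule e(2)) (use that assms dom_beyond e(1) in \<open>auto simp: dist_real_def\<close>)
  then show ?thesis using e(1) unfolding eventually_nhds_metric by blast
qed

lemma has_partial_cong:
  assumes "\<And>q. q \<in> U \<Longrightarrow> f q = g q" "p \<in> U" "i < m"
  shows "((\<lambda>t. f (p(i := t))) has_real_derivative d) (at (p i)) \<longleftrightarrow>
         ((\<lambda>t. g (p(i := t))) has_real_derivative d) (at (p i))"
  by (rule DERIV_cong_ev)
    (use eventually_mono[OF eventually_line[OF assms(2,3)]] assms(1) in auto)

lemma partial_cong:
  assumes "\<And>q. q \<in> U \<Longrightarrow> f q = g q" "p \<in> U" "i < m"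
  shows "partial i f p = partial i g p"
  unfolding partial_def deriv_def
  by (intro arg_cong[of _ _ Eps] ext has_partial_cong) (use assms in auto)

lemma cdiff_on_cong:
  assumes "\<And>q. q \<in> U \<Longrightarrow> f q = g q"
  shows "cdiff_on k m U f \<longleftrightarrow> cdiff_on k m U g"
proof (cases k)
  case 0
  then show ?thesis using assms by (simp cong: continuous_on_cong)
next
  case (Suc k)
  have "continuous_on U f \<longleftrightarrow> continuous_on U g"
    using assms by (simp cong: continuous_on_cong)
  moreover have "((\<lambda>t. f (p(i := t))) has_real_derivative d) (at (p i)) \<longleftrightarrow>
      ((\<lambda>t. g (p(i := t))) has_real_derivative d) (at (p i))" if "p \<in> U" "i < m" for p i d
    by (rule has_partial_cong) (use assms that in auto)
  ultimately show ?thesis using Suc by (simp cong: conj_cong)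
qed

lemma has_partial_imp_partial:
  "((\<lambda>t. f (p(i := t))) has_real_derivative d) (at (p i)) \<Longrightarrow> partial i f p = d"
  unfolding partial_def by (rule DERIV_imp_deriv)

lemma smooth_fun_on_iff_cdiff_on: "smooth_fun_on m U f \<longleftrightarrow> (\<forall>k. cdiff_on k m U f)"
proof
  show "smooth_fun_on m U f \<Longrightarrow> \<forall>k. cdiff_on k m U f"
    using smooth_fun_on_imp_cdiff_on by blast
next
  assume f: "\<forall>k. cdiff_on k m U f"
  have "\<forall>k. cdiff_on k m U (foldr partial is f)" if "is \<in> lists {..<m}" for "is"
    using that
  proof (induction "is")
    case (Cons i js)
    let ?h = "foldr partial js f"
    have i: "i < m" and h: "\<And>k. cdiff_on k m U ?h" using Cons by auto
    have "cdiff_on k m U (partial i ?h)" for k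
    proof -
      obtain g where g: "cdiff_on k m U g"
        "\<And>p. p\<in>U \<Longrightarrow> ((\<lambda>t. ?h (p(i := t))) has_real_derivative g p) (at (p i))"
        using h[of "Suc k"] i unfolding cdiff_on.simps by blast
      then show ?thesis using cdiff_on_cong[of "partial i ?h" g] has_partial_imp_partial by blast
    qed
    then show ?case by simp
  qed (use f in simp)
  then have "continuous_on U (foldr partial is f) \<and>
      (\<forall>p\<in>U. \<forall>i<m. (\<lambda>t. foldr partial is f (p(i := t))) differentiable at (p i))"
    if "is \<in> lists {..<m}" for "is"
    using that real_differentiable_def by (metis cdiff_on.simps)
  then show "smooth_fun_on m U f" unfolding smooth_fun_on_def by blast
qed

lemma smooth_cong:
  assumes "\<And>q. q \<in> U \<Longrightarrow> f q = g q"
  shows "smooth_fun_on m U f \<longleftrightarrow> smooth_fun_on m U g"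
  using cdiff_on_cong[OF assms] by (simp add: smooth_fun_on_iff_cdiff_on)

lemma cdiff_on_const: "cdiff_on k m U (\<lambda>_. c)"
proof (induction k arbitrary: c)
  case (Suc k)
  have "((\<lambda>t. c) has_real_derivative 0) (at x)" for x by simp
  then show ?case using Suc unfolding cdiff_on.simps by (auto intro!: exI[of _ "\<lambda>_. 0"])
qed simp

lemma cdiff_on_coord: "cdiff_on k m U (\<lambda>p. p j)"
proof (cases k)
  case (Suc k)
  have "\<exists>g. cdiff_on k m U g \<and> (\<forall>p\<in>U. ((\<lambda>t. (p(i := t)) j) has_real_derivative g p) (at (p i)))" for i
    by (rule exI[of _ "\<lambda>_. if i = j then 1 else 0"]) (auto intro: cdiff_on_const)
  moreover have "continuous_on U (\<lambda>p. p j)"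
    by (rule continuous_on_subset[OF continuous_on_product_coordinates]) simp
  ultimately show ?thesis using Suc by simp
qed (auto intro: continuous_on_subset[OF continuous_on_product_coordinates])

lemma cdiff_on_add: "cdiff_on k m U f \<Longrightarrow> cdiff_on k m U g \<Longrightarrow> cdiff_on k m U (\<lambda>p. f p + g p)"
proof (induction k arbitrary: f g)
  case (Suc k)
  have "\<exists>h. cdiff_on k m U h \<and>
        (\<forall>p\<in>U. ((\<lambda>t. f (p(i := t)) + g (p(i := t))) has_real_derivative h p) (at (p i)))"
    if "i < m" for i
  proof -
    obtain f' g' where *: "cdiff_on k m U f'" "cdiff_on k m U g'"
      "\<And>p. p\<in>U \<Longrightarrow> ((\<lambda>t. f (p(i := t))) has_real_derivative f' p) (at (p i))"
      "\<And>p. p\<in>U \<Longrightarrow> ((\<lambda>t. g (p(i := t))) has_real_derivative g' p) (at (p i))"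
      using Suc.prems \<open>i < m\<close> unfolding cdiff_on.simps by metis
    then have "\<And>p. p\<in>U \<Longrightarrow> ((\<lambda>t. f (p(i := t)) + g (p(i := t))) has_real_derivative f' p + g' p) (at (p i))"
      by (auto intro!: DERIV_add)
    then show ?thesis using Suc.IH[OF *(1,2)] by blast
  qed
  moreover have "continuous_on U (\<lambda>p. f p + g p)"
    using Suc.prems by (auto intro!: continuous_intros)
  ultimately show ?case by simp
qed (auto intro!: continuous_intros)

lemma cdiff_on_mult: "cdiff_on k m U f \<Longrightarrow> cdiff_on k m U g \<Longrightarrow> cdiff_on k m U (\<lambda>p. f p * g p)"
proof (induction k arbitrary: f g)
  case (Suc k)
  have "\<exists>h. cdiff_on k m U h \<and>
        (\<forall>p\<in>U. ((\<lambda>t. f (p(i := t)) * g (p(i := t))) has_real_derivative h p) (at (p i)))"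
    if "i < m" for i
  proof -
    obtain f' g' where *: "cdiff_on k m U f'" "cdiff_on k m U g'"
      "\<And>p. p\<in>U \<Longrightarrow> ((\<lambda>t. f (p(i := t))) has_real_derivative f' p) (at (p i))"
      "\<And>p. p\<in>U \<Longrightarrow> ((\<lambda>t. g (p(i := t))) has_real_derivative g' p) (at (p i))"
      using Suc.prems \<open>i < m\<close> unfolding cdiff_on.simps by metis
    have "((\<lambda>t. f (p(i := t)) * g (p(i := t))) has_real_derivative f' p * g p + g' p * f p) (at (p i))"
      if "p \<in> U" for p
      using DERIV_mult[OF *(3)[OF that] *(4)[OF that]] by simp
    moreover have "cdiff_on k m U (\<lambda>p. f' p * g p + g' p * f p)"
      using Suc.prems by (intro cdiff_on_add Suc.IH * ) (auto intro: cdiff_on_mono)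
    ultimately show ?thesis by blast
  qed
  moreover have "continuous_on U (\<lambda>p. f p * g p)"
    using Suc.prems by (auto intro!: continuous_intros)
  ultimately show ?case by simp
qed (auto intro!: continuous_intros)

lemma cdiff_on_inverse:
  assumes "\<And>p. p \<in> U \<Longrightarrow> f p \<noteq> 0"
  shows "cdiff_on k m U f \<Longrightarrow> cdiff_on k m U (\<lambda>p. inverse (f p))"
proof (induction k)
  case (Suc k)
  have "\<exists>h. cdiff_on k m U h \<and>
        (\<forall>p\<in>U. ((\<lambda>t. inverse (f (p(i := t)))) has_real_derivative h p) (at (p i)))"
    if "i < m" for i
  proof -
    obtain f' where *: "cdiff_on k m U f'" 
      "\<And>p. p\<in>U \<Longrightarrow> ((\<lambda>t. f (p(i := t))) has_real_derivative f' p) (at (p i))"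
      using Suc.prems \<open>i < m\<close> unfolding cdiff_on.simps by metis
    have "((\<lambda>t. inverse (f (p(i := t)))) has_real_derivative
        (-1) * (inverse (f p) * (f' p * inverse (f p)))) (at (p i))"
      if "p \<in> U" for p
      using DERIV_inverse'[OF *(2)[OF that]] assms that by (simp add: mult.assoc)
    moreover have "cdiff_on k m U (\<lambda>p. (-1) * (inverse (f p) * (f' p * inverse (f p))))"
      using Suc.IH[OF cdiff_on_mono[OF Suc.prems]] by (intro cdiff_on_mult * cdiff_on_const)
    ultimately show ?thesis by blast
  qed
  moreover have "continuous_on U (\<lambda>p. inverse (f p))"
    using Suc.prems assms by (auto intro!: continuous_intros)
  ultimately show ?case by simp
qed (use assms in \<open>auto intro!: continuous_intros\<close>)

lemma smooth_const: "smooth_fun_on m U (\<lambda>_. c)"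
  and smooth_coord: "smooth_fun_on m U (\<lambda>p. p j)"
  and smooth_add: "smooth_fun_on m U f \<Longrightarrow> smooth_fun_on m U g \<Longrightarrow> smooth_fun_on m U (\<lambda>p. f p + g p)"
  and smooth_mult: "smooth_fun_on m U f \<Longrightarrow> smooth_fun_on m U g \<Longrightarrow> smooth_fun_on m U (\<lambda>p. f p * g p)"
  by (simp_all add: smooth_fun_on_iff_cdiff_on cdiff_on_const cdiff_on_coord cdiff_on_add cdiff_on_mult)

lemma smooth_divide:
  "smooth_fun_on m U f \<Longrightarrow> smooth_fun_on m U g \<Longrightarrow> (\<And>p. p \<in> U \<Longrightarrow> g p \<noteq> 0) \<Longrightarrow>
    smooth_fun_on m U (\<lambda>p. f p / g p)"
  by (simp add: smooth_fun_on_iff_cdiff_on divide_inverse cdiff_on_mult cdiff_on_inverse)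

lemma smooth_minus: "smooth_fun_on m U f \<Longrightarrow> smooth_fun_on m U (\<lambda>p. - f p)"
  using smooth_mult[OF smooth_const[of "-1"], of f] by simp

lemma smooth_diff:
  "smooth_fun_on m U f \<Longrightarrow> smooth_fun_on m U g \<Longrightarrow> smooth_fun_on m U (\<lambda>p. f p - g p)"
  using smooth_add[OF _ smooth_minus, of f g] by simp

lemma smooth_sum:
  "(\<And>i. i \<in> I \<Longrightarrow> smooth_fun_on m U (f i)) \<Longrightarrow> smooth_fun_on m U (\<lambda>p. \<Sum>i\<in>I. f i p)"
  by (induction I rule: infinite_finite_induct) (auto intro!: smooth_const smooth_add)

lemmas smooth_intros = smooth_const smooth_coord smooth_add smooth_mult smooth_minus smooth_diff
  smooth_sum smooth_divide

lemma partial_const: "partial i (\<lambda>_. c) p = 0"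
  by (rule has_partial_imp_partial) simp

lemma partial_coord: "partial i (\<lambda>p. p j) p = (if i = j then 1 else 0)"
  by (rule has_partial_imp_partial) auto

context
  fixes f g :: "point \<Rightarrow> real" and p i
  assumes fg: "smooth_fun_on m U f" "smooth_fun_on m U g" and p: "p \<in> U" and i: "i < m"
begin

lemmas fg_deriv = fg[THEN smooth_fun_on_has_partial, OF p i]

lemma partial_add: "partial i (\<lambda>q. f q + g q) p = partial i f p + partial i g p"
  by (rule has_partial_imp_partial) (intro DERIV_add fg_deriv)

lemma partial_diff: "partial i (\<lambda>q. f q - g q) p = partial i f p - partial i g p"
  by (rule has_partial_imp_partial) (intro DERIV_diff fg_deriv)

lemma partial_mult: "partial i (\<lambda>q. f q * g q) p = partial i f p * g p + f p * partial i g p"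
  using has_partial_imp_partial[OF DERIV_mult[OF fg_deriv]] by (simp add: mult.commute)

lemma partial_divide: "g p \<noteq> 0 \<Longrightarrow>
    partial i (\<lambda>q. f q / g q) p = (partial i f p * g p - f p * partial i g p) / (g p * g p)"
  using has_partial_imp_partial[OF DERIV_divide[OF fg_deriv]] by simp

end

lemma partial_minus:
  assumes "smooth_fun_on m U f" "p \<in> U" "i < m"
  shows "partial i (\<lambda>q. - f q) p = - partial i f p"
  by (rule has_partial_imp_partial) (intro DERIV_minus smooth_fun_on_has_partial[OF assms])

lemma partial_sum:
  assumes "\<And>j. j \<in> I \<Longrightarrow> smooth_fun_on m U (f j)" "p \<in> U" "i < m"
  shows "partial i (\<lambda>q. \<Sum>j\<in>I. f j q) p = (\<Sum>j\<in>I. partial i (f j) p)"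
  by (rule has_partial_imp_partial) (auto intro!: DERIV_sum smooth_fun_on_has_partial assms)

end

lemma tendsto_coordinatewise:
  fixes l :: "'i \<Rightarrow> 'a::topological_space"
  assumes "\<And>i. ((\<lambda>t. f t i) \<longlongrightarrow> l i) F"
  shows "(f \<longlongrightarrow> l) F"
  using assms unfolding limitin_canonical_iff[symmetric] euclidean_product_topology[symmetric]
    limitin_componentwise by simp

context coordinate_domain begin

text \<open>Mean value theorem along the path from \<open>p\<close> to \<open>q\<close> that changes one coordinate at a time.\<close>

lemma increment_eq_sum_partial:
  assumes f: "smooth_fun_on m U f" and p: "p \<in> U"
  obtains e where "e > 0"
    "\<And>q. (\<And>i. i \<ge> m \<Longrightarrow> q i = 0) \<Longrightarrow> (\<And>i. i < m \<Longrightarrow> \<bar>q i - p i\<bar> < e) \<Longrightarrow>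
       \<exists>c. (\<forall>k<m. c k \<in> U \<and> (\<forall>i. \<bar>c k i - p i\<bar> \<le> \<bar>q i - p i\<bar>)) \<and>
           f q - f p = (\<Sum>k<m. (q k - p k) * partial k f (c k))"
proof -
  obtain e where e: "e > 0"
    "\<And>q. (\<And>i. i \<ge> m \<Longrightarrow> q i = 0) \<Longrightarrow> (\<And>i. i < m \<Longrightarrow> \<bar>q i - p i\<bar> < e) \<Longrightarrow> q \<in> U"
    using Euclidean_space_open_box[OF open_dom p] by blast
  have p0: "p i = 0" if "i \<ge> m" for i using dom_beyond p that by auto
  show thesis
  proof (rule that[OF e(1)])
    fix q assume q: "\<And>i. i \<ge> m \<Longrightarrow> q i = 0" "\<And>i. i < m \<Longrightarrow> \<bar>q i - p i\<bar> < e"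
    define r where "r k = (\<lambda>i. if i < k then q i else p i)" for k
    have "\<exists>c. c \<in> U \<and> (\<forall>i. \<bar>c i - p i\<bar> \<le> \<bar>q i - p i\<bar>) \<and>
              f (r (Suc k)) - f (r k) = (q k - p k) * partial k f c" if k: "k < m" for k
    proof -
      have box: "(r k)(k := t) \<in> U" "\<forall>i. \<bar>((r k)(k := t)) i - p i\<bar> \<le> \<bar>q i - p i\<bar>"
        if "t \<in> closed_segment (p k) (q k)" for t
      proof -
        have t: "\<bar>t - p k\<bar> \<le> \<bar>q k - p k\<bar>"
          using that by (auto simp: closed_segment_eq_real_ivl split: if_splits)
        then show "\<forall>i. \<bar>((r k)(k := t)) i - p i\<bar> \<le> \<bar>q i - p i\<bar>" by (auto simp: r_def)
        show "(r k)(k := t) \<in> U"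
          by (rule e(2)) (use t q p0 k in \<open>force simp: r_def\<close>)+
      qed
      have der: "((\<lambda>t. f ((r k)(k := t))) has_real_derivative partial k f ((r k)(k := t))) (at t)"
        if "t \<in> closed_segment (p k) (q k)" for t
        using smooth_fun_on_has_partial[OF f box(1)[OF that] k] by simp
      have r: "(r k)(k := q k) = r (Suc k)" "(r k)(k := p k) = r k"
        by (auto simp: r_def less_Suc_eq)
      consider "p k = q k" | "p k < q k" | "q k < p k" by linarith
      then obtain t where t: "t \<in> closed_segment (p k) (q k)"
        "f ((r k)(k := q k)) - f ((r k)(k := p k)) = (q k - p k) * partial k f ((r k)(k := t))"
      proof cases
        case 1
        then show ?thesis using that[of "p k"] by simp
      next
        case 2
        have "\<exists>z. p k < z \<and> z < q k \<and> f ((r k)(k := q k)) - f ((r k)(k := p k)) =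
          (q k - p k) * partial k f ((r k)(k := z))"
          by (rule MVT2[OF 2], rule der) (use 2 in \<open>simp add: closed_segment_eq_real_ivl\<close>)
        then obtain z where "p k < z" "z < q k" "f ((r k)(k := q k)) - f ((r k)(k := p k)) =
          (q k - p k) * partial k f ((r k)(k := z))" by blast
        then show ?thesis using that[of z] 2 by (auto simp: closed_segment_eq_real_ivl)
      next
        case 3
        have "\<exists>z. q k < z \<and> z < p k \<and> f ((r k)(k := p k)) - f ((r k)(k := q k)) =
          (p k - q k) * partial k f ((r k)(k := z))"
          by (rule MVT2[OF 3], rule der) (use 3 in \<open>simp add: closed_segment_eq_real_ivl\<close>)
        then obtain z where "q k < z" "z < p k" "f ((r k)(k := p k)) - f ((r k)(k := q k)) =
          (p k - q k) * partial k f ((r k)(k := z))" by blast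
        then show ?thesis using that[of z] 3 by (auto simp: closed_segment_eq_real_ivl algebra_simps)
      qed
      show ?thesis using t box[OF t(1)] unfolding r by blast
    qed
    then obtain c where c: "\<And>k. k < m \<Longrightarrow> c k \<in> U \<and> (\<forall>i. \<bar>c k i - p i\<bar> \<le> \<bar>q i - p i\<bar>) \<and>
              f (r (Suc k)) - f (r k) = (q k - p k) * partial k f (c k)" by metis
    have "r m = q" "r 0 = p" using q(1) p0 by (auto simp: r_def)
    then have "f q - f p = (\<Sum>k<m. f (r (Suc k)) - f (r k))"
      using sum_lessThan_telescope[of "\<lambda>k. f (r k)" m] by simp
    also have "\<dots> = (\<Sum>k<m. (q k - p k) * partial k f (c k))"
      using c by (intro sum.cong) auto
    finally show "\<exists>c. (\<forall>k<m. c k \<in> U \<and> (\<forall>i. \<bar>c k i - p i\<bar> \<le> \<bar>q i - p i\<bar>)) \<and>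
           f q - f p = (\<Sum>k<m. (q k - p k) * partial k f (c k))"
      using c by blast
  qed
qed

text \<open>The chain rule for a curve through \<open>p\<close>, from the increment formula: the intermediate points lie
  between \<open>p\<close> and the point on the curve, so the continuous partial derivatives taken there converge to
  those at \<open>p\<close>.\<close>

lemma chain_rule_curve:
  assumes f: "smooth_fun_on m U f" and p: "\<gamma> t0 \<in> U"
    and \<gamma>0: "\<And>t i. i \<ge> m \<Longrightarrow> \<gamma> t i = 0"
    and \<gamma>: "\<And>i. i < m \<Longrightarrow> ((\<lambda>t. \<gamma> t i) has_real_derivative \<gamma>' i) (at t0)"
  shows "((\<lambda>t. f (\<gamma> t)) has_real_derivative (\<Sum>i<m. \<gamma>' i * partial i f (\<gamma> t0))) (at t0)"
proof -
  obtain e where e: "e > 0" and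
    ex: "\<And>q. (\<And>i. i \<ge> m \<Longrightarrow> q i = 0) \<Longrightarrow> (\<And>i. i < m \<Longrightarrow> \<bar>q i - \<gamma> t0 i\<bar> < e) \<Longrightarrow>
       \<exists>c. (\<forall>k<m. c k \<in> U \<and> (\<forall>i. \<bar>c k i - \<gamma> t0 i\<bar> \<le> \<bar>q i - \<gamma> t0 i\<bar>)) \<and>
           f q - f (\<gamma> t0) = (\<Sum>k<m. (q k - \<gamma> t0 k) * partial k f (c k))"
    using increment_eq_sum_partial[OF f p] by blast
  have lim: "((\<lambda>t. \<gamma> t i) \<longlongrightarrow> \<gamma> t0 i) (at t0)" for i
  proof (cases "i < m")
    case True
    then show ?thesis using DERIV_isCont[OF \<gamma>] unfolding isCont_def by blast
  qed (simp add: \<gamma>0)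
  have "\<forall>\<^sub>F t in at t0. \<forall>i\<in>{..<m}. \<bar>\<gamma> t i - \<gamma> t0 i\<bar> < e"
  proof (rule eventually_ball_finite)
    show "\<forall>i\<in>{..<m}. \<forall>\<^sub>F t in at t0. \<bar>\<gamma> t i - \<gamma> t0 i\<bar> < e"
      using tendstoD[OF lim e] by (simp add: dist_real_def)
  qed simp
  then have "\<forall>\<^sub>F t in at t0. \<exists>c. (\<forall>k<m. c k \<in> U \<and> (\<forall>i. \<bar>c k i - \<gamma> t0 i\<bar> \<le> \<bar>\<gamma> t i - \<gamma> t0 i\<bar>)) \<and>
           f (\<gamma> t) - f (\<gamma> t0) = (\<Sum>k<m. (\<gamma> t k - \<gamma> t0 k) * partial k f (c k))"
    by (rule eventually_mono) (rule ex, use \<gamma>0 in auto)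
  then obtain c where c: "\<forall>\<^sub>F t in at t0. 
     (\<forall>k<m. c t k \<in> U \<and> (\<forall>i. \<bar>c t k i - \<gamma> t0 i\<bar> \<le> \<bar>\<gamma> t i - \<gamma> t0 i\<bar>)) \<and>
           f (\<gamma> t) - f (\<gamma> t0) = (\<Sum>k<m. (\<gamma> t k - \<gamma> t0 k) * partial k f (c t k))"
    by (auto simp: eventually_ex)
  have "((\<lambda>t. partial k f (c t k)) \<longlongrightarrow> partial k f (\<gamma> t0)) (at t0)" if k: "k < m" for k
  proof (rule continuous_on_tendsto_compose[of U "partial k f" "\<lambda>t. c t k" "\<gamma> t0"])
    show "continuous_on U (partial k f)"
      using smooth_fun_on_continuous[OF smooth_fun_on_partial[OF f k]] .
    show "\<gamma> t0 \<in> U" by fact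
    show "\<forall>\<^sub>F t in at t0. c t k \<in> U" using c k by (auto elim: eventually_mono)
    show "((\<lambda>t. c t k) \<longlongrightarrow> \<gamma> t0) (at t0)"
    proof (rule tendsto_coordinatewise)
      fix i
      have "((\<lambda>t. c t k i - \<gamma> t0 i) \<longlongrightarrow> 0) (at t0)"
      proof (rule Lim_null_comparison)
        show "\<forall>\<^sub>F t in at t0. norm (c t k i - \<gamma> t0 i) \<le> \<bar>\<gamma> t i - \<gamma> t0 i\<bar>"
          using c k by (auto elim!: eventually_mono)
        show "((\<lambda>t. \<bar>\<gamma> t i - \<gamma> t0 i\<bar>) \<longlongrightarrow> 0) (at t0)"
          using tendsto_rabs_zero[OF LIM_zero[OF lim]] by simp
      qed
      then show "((\<lambda>t. c t k i) \<longlongrightarrow> \<gamma> t0 i) (at t0)" by (rule LIM_zero_cancel)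
    qed
  qed
  then have "((\<lambda>t. \<Sum>k<m. (\<gamma> t k - \<gamma> t0 k) / (t - t0) * partial k f (c t k)) \<longlongrightarrow>
      (\<Sum>i<m. \<gamma>' i * partial i f (\<gamma> t0))) (at t0)"
    using \<gamma> by (intro tendsto_sum tendsto_mult) (auto simp: has_field_derivative_iff)
  moreover have "\<forall>\<^sub>F t in at t0. (\<Sum>k<m. (\<gamma> t k - \<gamma> t0 k) / (t - t0) * partial k f (c t k)) =
      (f (\<gamma> t) - f (\<gamma> t0)) / (t - t0)"
    using c by (auto elim!: eventually_mono simp: sum_divide_distrib)
  ultimately show ?thesis unfolding has_field_derivative_iff
    by (rule Lim_transform_eventually)
qed

lemma has_partial_compose:
  assumes V: "coordinate_domain l V"
    and f: "smooth_fun_on l V f" and g: "\<And>p. p \<in> U \<Longrightarrow> g p \<in> V"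
    and gs: "\<And>i. i < l \<Longrightarrow> smooth_fun_on m U (\<lambda>p. g p i)" and p: "p \<in> U" and j: "j < m"
  shows "((\<lambda>t. f (g (p(j := t)))) has_real_derivative
          (\<Sum>i<l. partial j (\<lambda>p. g p i) p * partial i f (g p))) (at (p j))"
proof -
  interpret V: coordinate_domain l V by fact
  have "\<forall>\<^sub>F t in nhds (p j). (\<lambda>i. if i < l then g (p(j := t)) i else 0) = g (p(j := t))"
    using eventually_line[OF p j]
    by (rule eventually_mono) (auto simp: fun_eq_iff V.dom_beyond[OF g])
  then have "\<forall>\<^sub>F t in nhds (p j). f (g (p(j := t))) = f (\<lambda>i. if i < l then g (p(j := t)) i else 0)"
    by (rule eventually_mono) simp
  moreover have gp: "(\<lambda>i. if i < l then g p i else 0) = g p"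
    using V.dom_beyond[OF g[OF p]] by auto
  have "((\<lambda>t. f (\<lambda>i. if i < l then g (p(j := t)) i else 0)) has_real_derivative
       (\<Sum>i<l. partial j (\<lambda>p. g p i) p * partial i f (\<lambda>i. if i < l then g (p(j := p j)) i else 0))) (at (p j))"
  proof (rule V.chain_rule_curve[OF f])
    show "(\<lambda>i. if i < l then g (p(j := p j)) i else 0) \<in> V" using gp g[OF p] by (simp only: fun_upd_triv)
    show "((\<lambda>t. if i < l then g (p(j := t)) i else 0) has_real_derivative
          partial j (\<lambda>p. g p i) p) (at (p j))" if "i < l" for i
      using smooth_fun_on_has_partial[OF gs[OF that] p j] that by simp
  qed auto
  ultimately show ?thesis unfolding fun_upd_triv gp by (simp only: DERIV_cong_ev)
qed

lemma partial_compose: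
  assumes "coordinate_domain l V"
    and "smooth_fun_on l V f" and "\<And>p. p \<in> U \<Longrightarrow> g p \<in> V"
    and "\<And>i. i < l \<Longrightarrow> smooth_fun_on m U (\<lambda>p. g p i)" and "p \<in> U" and "j < m"
  shows "partial j (\<lambda>q. f (g q)) p = (\<Sum>i<l. partial j (\<lambda>p. g p i) p * partial i f (g p))"
  by (rule has_partial_imp_partial[OF has_partial_compose[OF assms]])

lemma cdiff_on_sum:
  "(\<And>i. i \<in> I \<Longrightarrow> cdiff_on k m U (f i)) \<Longrightarrow> cdiff_on k m U (\<lambda>p. \<Sum>i\<in>I. f i p)"
  by (induction I rule: infinite_finite_induct) (auto intro!: cdiff_on_const cdiff_on_add)

text \<open>The derivatives of a composition are sums of products of smooth functions and compositions of
  the same kind, so regularity follows by induction on the order.\<close>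

lemma smooth_compose:
  assumes V: "coordinate_domain l V" and f: "smooth_fun_on l V f"
    and g: "\<And>p. p \<in> U \<Longrightarrow> g p \<in> V" and gs: "\<And>i. i < l \<Longrightarrow> smooth_fun_on m U (\<lambda>p. g p i)"
  shows "smooth_fun_on m U (\<lambda>p. f (g p))"
proof -
  interpret V: coordinate_domain l V by fact
  have g0: "g p i = 0" if "p \<in> U" "\<not> i < l" for p i using V.dom_beyond[OF g] that by auto
  have "continuous_on U (\<lambda>p. g p i)" for i
  proof (cases "i < l")
    case False
    then have "continuous_on U (\<lambda>p. g p i) \<longleftrightarrow> continuous_on U (\<lambda>p. 0::real)"
      using g0 by (intro continuous_on_cong) auto
    then show ?thesis by simp
  qed (auto intro: smooth_fun_on_continuous gs)
  then have gc: "continuous_on U g" by (rule continuous_on_coordinatewise_then_product)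
  have cont: "continuous_on U (\<lambda>p. f (g p))" if "smooth_fun_on l V f" for f
    using continuous_on_compose2[OF smooth_fun_on_continuous[OF that] gc] g by auto
  have "cdiff_on k m U (\<lambda>p. f (g p))" if "smooth_fun_on l V f" for k f
    using that
  proof (induction k arbitrary: f)
    case (Suc k)
    have "cdiff_on k m U (\<lambda>p. \<Sum>i<l. partial j (\<lambda>p. g p i) p * partial i f (g p))" if "j < m" for j
      using that Suc gs
      by (intro cdiff_on_sum cdiff_on_mult Suc.IH smooth_fun_on_imp_cdiff_on[of m U "partial j _"])
        (auto intro!: smooth_fun_on_partial)
    then show ?case using cont[OF Suc.prems] has_partial_compose[OF V Suc.prems g gs]
      unfolding cdiff_on.simps by blast
  qed (simp add: cont)
  then show ?thesis using f by (simp add: smooth_fun_on_iff_cdiff_on)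
qed

end

text \<open>\<^const>\<open>vf_apply\<close> in any dimension.  The vector field is given by its component functions, so that
  families of functions on jet spaces can serve as vector fields.\<close>

definition vf_deriv :: "nat \<Rightarrow> (nat \<Rightarrow> point \<Rightarrow> real) \<Rightarrow> (point \<Rightarrow> real) \<Rightarrow> point \<Rightarrow> real"
  where "vf_deriv m a f p = (\<Sum>i<m. a i p * partial i f p)"

context coordinate_domain begin

text \<open>The second difference quotient, evaluated by the mean value theorem in one order of the two
  variables.  Its symmetry in \<open>i\<close> and \<open>j\<close> gives the symmetry of second derivatives.\<close>

lemma second_difference_quotient:
  assumes f: "smooth_fun_on m U f" and p: "p \<in> U" and i: "i < m" and j: "j < m" and ij: "i \<noteq> j"
  shows "((\<lambda>h. (f (p(i := p i + h, j := p j + h)) - f (p(i := p i + h)) - f (p(j := p j + h)) + f p) / h\<^sup>2)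
     \<longlongrightarrow> partial j (partial i f) p) (at_right 0)"
proof -
  define \<Delta> where "\<Delta> h = f (p(i := p i + h, j := p j + h)) - f (p(i := p i + h)) - f (p(j := p j + h)) + f p" for h
  obtain e where e: "e > 0"
    "\<And>q. (\<And>i. i \<ge> m \<Longrightarrow> q i = 0) \<Longrightarrow> (\<And>i. i < m \<Longrightarrow> \<bar>q i - p i\<bar> < e) \<Longrightarrow> q \<in> U"
    using Euclidean_space_open_box[OF open_dom p] by blast
  have box: "p(i := s, j := t) \<in> U" if "\<bar>s - p i\<bar> < e" "\<bar>t - p j\<bar> < e" for s t
    by (rule e(2)) (use that i j dom_beyond[OF p] e(1) in auto)
  have "\<exists>c. c \<in> U \<and> (\<forall>k. \<bar>c k - p k\<bar> \<le> h) \<and> \<Delta> h = h\<^sup>2 * partial j (partial i f) c"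
    if h: "0 < h" "h < e" for h
  proof -
    let ?G = "\<lambda>s. f (p(i := s, j := p j + h)) - f (p(i := s, j := p j))"
    have dG: "(?G has_real_derivative
        partial i f (p(i := s, j := p j + h)) - partial i f (p(i := s, j := p j))) (at s)"
      if "p i \<le> s" "s \<le> p i + h" for s
    proof -
      have "((\<lambda>s. f (p(i := s, j := t))) has_real_derivative partial i f (p(i := s, j := t))) (at s)"
        if "\<bar>t - p j\<bar> < e" for t
      proof -
        have "p(i := s, j := t) \<in> U" using that \<open>p i \<le> s\<close> \<open>s \<le> p i + h\<close> h by (intro box) auto
        from smooth_fun_on_has_partial[OF f this i] show ?thesis
          using ij by (simp add: fun_upd_twist)
      qed
      from DERIV_diff[OF this this] show ?thesis using h e(1) by simp
    qed
    obtain s where s: "p i < s" "s < p i + h"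
      "?G (p i + h) - ?G (p i) =
        (p i + h - p i) * (partial i f (p(i := s, j := p j + h)) - partial i f (p(i := s, j := p j)))"
      using MVT2[of "p i" "p i + h" ?G, OF _ dG] h by auto
    have dH: "((\<lambda>t. partial i f (p(i := s, j := t))) has_real_derivative
        partial j (partial i f) (p(i := s, j := t))) (at t)"
      if "p j \<le> t" "t \<le> p j + h" for t
    proof -
      have "p(i := s, j := t) \<in> U" using that s h by (intro box) auto
      from smooth_fun_on_has_partial[OF smooth_fun_on_partial[OF f i] this j] show ?thesis by simp
    qed
    obtain t where t: "p j < t" "t < p j + h"
      "partial i f (p(i := s, j := p j + h)) - partial i f (p(i := s, j := p j)) =
        (p j + h - p j) * partial j (partial i f) (p(i := s, j := t))"
      using MVT2[of "p j" "p j + h" "\<lambda>t. partial i f (p(i := s, j := t))", OF _ dH] h by auto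
    have G: "?G (p i + h) - ?G (p i) = \<Delta> h"
      using ij by (simp add: \<Delta>_def fun_upd_idem)
    have "\<Delta> h = h\<^sup>2 * partial j (partial i f) (p(i := s, j := t))"
      using s(3) t(3) unfolding G by (simp add: power2_eq_square)
    moreover have "p(i := s, j := t) \<in> U" using s t h by (intro box) auto
    moreover have "\<forall>k. \<bar>(p(i := s, j := t)) k - p k\<bar> \<le> h" using s t h by auto
    ultimately show ?thesis by blast
  qed
  then obtain c where c: "\<And>h. 0 < h \<Longrightarrow> h < e \<Longrightarrow>
      c h \<in> U \<and> (\<forall>k. \<bar>c h k - p k\<bar> \<le> h) \<and> \<Delta> h = h\<^sup>2 * partial j (partial i f) (c h)" by metis
  have ev: "\<forall>\<^sub>F h in at_right 0. 0 < h \<and> h < e"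
    using e(1) by (auto simp: eventually_at_right_field)
  have "((\<lambda>h. partial j (partial i f) (c h)) \<longlongrightarrow> partial j (partial i f) p) (at_right 0)"
  proof (rule continuous_on_tendsto_compose[of U "partial j (partial i f)" c p])
    show "continuous_on U (partial j (partial i f))"
      using smooth_fun_on_continuous[OF smooth_fun_on_partial[OF smooth_fun_on_partial[OF f i] j]] .
    show "\<forall>\<^sub>F h in at_right 0. c h \<in> U" using ev by (rule eventually_mono) (simp add: c)
    show "(c \<longlongrightarrow> p) (at_right 0)"
    proof (rule tendsto_coordinatewise)
      fix k
      have "((\<lambda>h. c h k - p k) \<longlongrightarrow> 0) (at_right 0)"
      proof (rule Lim_null_comparison)
        show "\<forall>\<^sub>F h in at_right 0. norm (c h k - p k) \<le> h"
          using ev by (rule eventually_mono) (simp add: c)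
        show "((\<lambda>h. h) \<longlongrightarrow> 0) (at_right (0::real))" by (rule tendsto_ident_at)
      qed
      then show "((\<lambda>h. c h k) \<longlongrightarrow> p k) (at_right 0)" by (rule LIM_zero_cancel)
    qed
  qed fact
  moreover have "\<forall>\<^sub>F h in at_right 0. partial j (partial i f) (c h) = \<Delta> h / h\<^sup>2"
    using ev by (rule eventually_mono) (use c in auto)
  ultimately show ?thesis unfolding \<Delta>_def by (rule Lim_transform_eventually)
qed

lemma partial_commute:
  assumes f: "smooth_fun_on m U f" and p: "p \<in> U" and i: "i < m" and j: "j < m"
  shows "partial i (partial j f) p = partial j (partial i f) p"
proof (cases "i = j")
  case False
  have eq: "(f (p(j := p j + h, i := p i + h)) - f (p(j := p j + h)) - f (p(i := p i + h)) + f p) / h\<^sup>2 =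
    (f (p(i := p i + h, j := p j + h)) - f (p(i := p i + h)) - f (p(j := p j + h)) + f p) / h\<^sup>2" for h
    using False by (simp add: fun_upd_twist)
  show ?thesis
    using second_difference_quotient[OF f p i j False]
      second_difference_quotient[OF f p j i False[symmetric], unfolded eq]
    by (intro tendsto_unique[OF trivial_limit_at_right_real])
qed simp

lemma vf_deriv_cong:
  assumes "\<And>q. q \<in> U \<Longrightarrow> f q = g q" "p \<in> U"
  shows "vf_deriv m a f p = vf_deriv m a g p"
  using partial_cong[OF assms] by (simp add: vf_deriv_def)

lemma smooth_vf_deriv:
  "(\<And>i. i < m \<Longrightarrow> smooth_fun_on m U (a i)) \<Longrightarrow> smooth_fun_on m U f \<Longrightarrow>
    smooth_fun_on m U (vf_deriv m a f)"
  unfolding vf_deriv_def[abs_def] by (intro smooth_intros smooth_fun_on_partial) auto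

lemma vf_deriv_const: "vf_deriv m a (\<lambda>_. c) p = 0"
  by (simp add: vf_deriv_def partial_const)

lemma vf_deriv_coord: "j < m \<Longrightarrow> vf_deriv m a (\<lambda>p. p j) p = a j p"
  by (simp add: vf_deriv_def partial_coord if_distrib cong: if_cong)

lemma vf_deriv_minus: "smooth_fun_on m U f \<Longrightarrow> p \<in> U \<Longrightarrow>
    vf_deriv m a (\<lambda>q. - f q) p = - vf_deriv m a f p"
  by (simp add: vf_deriv_def partial_minus sum_negf)

lemma vf_deriv_diff: "smooth_fun_on m U f \<Longrightarrow> smooth_fun_on m U g \<Longrightarrow> p \<in> U \<Longrightarrow>
    vf_deriv m a (\<lambda>q. f q - g q) p = vf_deriv m a f p - vf_deriv m a g p"
  by (simp add: vf_deriv_def partial_diff ring_distribs sum_subtractf)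

lemma vf_deriv_mult: "smooth_fun_on m U f \<Longrightarrow> smooth_fun_on m U g \<Longrightarrow> p \<in> U \<Longrightarrow>
    vf_deriv m a (\<lambda>q. f q * g q) p = vf_deriv m a f p * g p + f p * vf_deriv m a g p"
  by (simp add: vf_deriv_def partial_mult ring_distribs sum.distrib sum_distrib_left
      sum_distrib_right ac_simps)

lemma vf_deriv_divide:
  assumes "smooth_fun_on m U f" "smooth_fun_on m U g" "p \<in> U" "g p \<noteq> 0"
  shows "vf_deriv m a (\<lambda>q. f q / g q) p =
    (vf_deriv m a f p * g p - f p * vf_deriv m a g p) / (g p * g p)"
proof -
  have "vf_deriv m a (\<lambda>q. f q / g q) p =
    (\<Sum>i<m. (a i p * partial i f p * g p - f p * (a i p * partial i g p)) / (g p * g p))"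
    unfolding vf_deriv_def using assms by (intro sum.cong) (auto simp: partial_divide algebra_simps)
  then show ?thesis
    by (simp add: vf_deriv_def sum_subtractf sum_distrib_left sum_distrib_right sum_divide_distrib diff_divide_distrib)
qed

lemma vf_deriv_compose:
  assumes "coordinate_domain l V" "smooth_fun_on l V f" "\<And>p. p \<in> U \<Longrightarrow> g p \<in> V"
    "\<And>i. i < l \<Longrightarrow> smooth_fun_on m U (\<lambda>p. g p i)" "p \<in> U"
  shows "vf_deriv m a (\<lambda>q. f (g q)) p = (\<Sum>i<l. vf_deriv m a (\<lambda>p. g p i) p * partial i f (g p))"
proof -
  have "vf_deriv m a (\<lambda>q. f (g q)) p =
      (\<Sum>j<m. \<Sum>i<l. a j p * partial j (\<lambda>p. g p i) p * partial i f (g p))"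
    unfolding vf_deriv_def using assms
    by (intro sum.cong) (auto simp: partial_compose sum_distrib_left mult.assoc)
  also have "\<dots> = (\<Sum>i<l. \<Sum>j<m. a j p * partial j (\<lambda>p. g p i) p * partial i f (g p))"
    by (rule sum.swap)
  finally show ?thesis by (simp add: vf_deriv_def sum_distrib_right)
qed

text \<open>The commutator of two derivations is a derivation: the second-order terms cancel by symmetry
  of second derivatives.\<close>

lemma vf_deriv_commute:
  assumes a: "\<And>i. i < m \<Longrightarrow> smooth_fun_on m U (a i)" and b: "\<And>i. i < m \<Longrightarrow> smooth_fun_on m U (b i)"
    and f: "smooth_fun_on m U f" and p: "p \<in> U"
  shows "vf_deriv m a (vf_deriv m b f) p - vf_deriv m b (vf_deriv m a f) p =
    (\<Sum>j<m. (vf_deriv m a (b j) p - vf_deriv m b (a j) p) * partial j f p)"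
proof -
  have expand: "vf_deriv m a (vf_deriv m b f) p =
      (\<Sum>j<m. vf_deriv m a (b j) p * partial j f p) +
      (\<Sum>i<m. \<Sum>j<m. a i p * b j p * partial i (partial j f) p)"
    if a: "\<And>i. i < m \<Longrightarrow> smooth_fun_on m U (a i)" and b: "\<And>i. i < m \<Longrightarrow> smooth_fun_on m U (b i)"
    for a b
  proof -
    have "partial i (vf_deriv m b f) p =
        (\<Sum>j<m. partial i (b j) p * partial j f p + b j p * partial i (partial j f) p)" if "i < m" for i
      unfolding vf_deriv_def[abs_def]
      by (subst partial_sum)
        (use that b f p in \<open>auto intro!: smooth_intros smooth_fun_on_partial sum.cong partial_mult\<close>)
    then have "vf_deriv m a (vf_deriv m b f) p =
        (\<Sum>i<m. \<Sum>j<m. a i p * partial i (b j) p * partial j f p) +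
        (\<Sum>i<m. \<Sum>j<m. a i p * b j p * partial i (partial j f) p)"
      unfolding vf_deriv_def[of m a]
      by (simp add: sum_distrib_left sum.distrib ring_distribs mult.assoc)
    also have "(\<Sum>i<m. \<Sum>j<m. a i p * partial i (b j) p * partial j f p) =
        (\<Sum>j<m. vf_deriv m a (b j) p * partial j f p)"
      by (subst sum.swap) (simp add: vf_deriv_def sum_distrib_right)
    finally show ?thesis .
  qed
  have "(\<Sum>i<m. \<Sum>j<m. a i p * b j p * partial i (partial j f) p) =
      (\<Sum>i<m. \<Sum>j<m. a j p * b i p * partial j (partial i f) p)"
    by (rule sum.swap)
  also have "\<dots> = (\<Sum>i<m. \<Sum>j<m. b i p * a j p * partial i (partial j f) p)"
    using partial_commute[OF f p] by (intro sum.cong) (auto simp: mult.commute)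
  finally show ?thesis
    using expand[OF a b] expand[OF b a] by (simp add: left_diff_distrib sum_subtractf)
qed

end

section \<open>Vector fields and diffeomorphisms\<close>

lemma sum_lessThan_3: "(\<Sum>i<(3::nat). f i) = f 0 + f 1 + (f 2 :: 'a :: comm_monoid_add)"
  by (simp add: numeral_3_eq_3 numeral_2_eq_2 add.assoc)

lemma vf_apply_eq_vf_deriv: "vf_apply X f = vf_deriv 3 (\<lambda>j p. X p j) f"
  by (simp add: vf_apply_def vf_deriv_def fun_eq_iff)

lemma vector_field_on_smooth: "vector_field_on M X \<Longrightarrow> i < 3 \<Longrightarrow> smooth_fun_on 3 M (\<lambda>p. X p i)"
  by (simp add: vector_field_on_def)

lemma vector_field_on_beyond: "vector_field_on M X \<Longrightarrow> i \<ge> 3 \<Longrightarrow> X p i = 0"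
  by (cases "p \<in> M") (auto simp: vector_field_on_def zero_fun_def)

lemma vector_field_on_outside: "vector_field_on M X \<Longrightarrow> p \<notin> M \<Longrightarrow> X p i = 0"
  by (auto simp: vector_field_on_def zero_fun_def)

lemma vector_field_on_eqI:
  assumes "vector_field_on M X" "vector_field_on M Y" "\<And>p i. p \<in> M \<Longrightarrow> i < 3 \<Longrightarrow> X p i = Y p i"
  shows "X = Y"
proof (intro ext)
  fix p i
  show "X p i = Y p i"
    using assms vector_field_on_beyond[of M X i p] vector_field_on_beyond[of M Y i p]
      vector_field_on_outside[of M X p i] vector_field_on_outside[of M Y p i]
    by (cases "p \<in> M"; cases "i < 3") auto
qed

locale base_diffeo = coordinate_domain 3 M for M +
  fixes \<Gamma> :: "point \<Rightarrow> point"
  assumes diffeo: "diffeo_on M \<Gamma>"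
begin

lemma vector_field_on_add:
  "vector_field_on M X \<Longrightarrow> vector_field_on M Y \<Longrightarrow> vector_field_on M (X + Y)"
  by (auto simp: vector_field_on_def zero_fun_def intro!: smooth_add)

lemma vector_field_on_scaleR: "vector_field_on M X \<Longrightarrow> vector_field_on M (c *\<^sub>R X)"
  by (auto simp: vector_field_on_def zero_fun_def scaleR_fun_def fun_eq_iff intro!: smooth_intros)

lemma vector_field_on_commutator:
  assumes X: "vector_field_on M X" and Y: "vector_field_on M Y"
  shows "vector_field_on M (commutator X Y)"
  unfolding vector_field_on_def
proof (intro conjI allI impI ballI)
  fix p assume "p \<notin> M"
  then show "commutator X Y p = 0"
    using vector_field_on_outside[OF X] vector_field_on_outside[OF Y]
    by (auto simp: commutator_def vf_apply_def fun_eq_iff)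
next
  fix p and i :: nat assume "p \<in> M" "i \<ge> 3"
  then show "commutator X Y p i = 0"
    using vector_field_on_beyond[OF X] vector_field_on_beyond[OF Y]
    by (simp add: commutator_def vf_apply_def partial_const)
next
  fix i :: nat assume "i < 3"
  then show "smooth_fun_on 3 M (\<lambda>p. commutator X Y p i)"
    unfolding commutator_def vf_apply_eq_vf_deriv
    by (intro smooth_diff smooth_vf_deriv vector_field_on_smooth X Y)
qed

lemma \<Gamma>_in: "p \<in> M \<Longrightarrow> \<Gamma> p \<in> M"
  and inv_in: "p \<in> M \<Longrightarrow> inv_into M \<Gamma> p \<in> M"
  and inv_\<Gamma>: "p \<in> M \<Longrightarrow> inv_into M \<Gamma> (\<Gamma> p) = p"
  and \<Gamma>_inv: "p \<in> M \<Longrightarrow> \<Gamma> (inv_into M \<Gamma> p) = p"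
  and smooth_\<Gamma>: "i < 3 \<Longrightarrow> smooth_fun_on 3 M (\<lambda>p. \<Gamma> p i)"
  and smooth_inv: "i < 3 \<Longrightarrow> smooth_fun_on 3 M (\<lambda>p. inv_into M \<Gamma> p i)"
  using diffeo bij_betw_inv_into_left[of \<Gamma> M M] bij_betw_inv_into_right[of \<Gamma> M M]
    bij_betw_inv_into[of \<Gamma> M M]
  unfolding diffeo_on_def by (auto dest: bij_betwE)

text \<open>The Jacobian matrix of the inverse map, taken at \<open>\<Gamma> p\<close>, inverts that of \<open>\<Gamma>\<close> at \<open>p\<close>.\<close>

definition inv_jacobian :: "nat \<Rightarrow> nat \<Rightarrow> point \<Rightarrow> real"
  where "inv_jacobian j k p = partial k (\<lambda>q. inv_into M \<Gamma> q j) (\<Gamma> p)"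

lemma inv_jacobian_left:
  assumes "p \<in> M" "i < 3" "j < 3"
  shows "(\<Sum>k<3. partial i (\<lambda>q. \<Gamma> q k) p * inv_jacobian j k p) = (if i = j then 1 else 0)"
proof -
  have "(\<Sum>k<3. partial i (\<lambda>q. \<Gamma> q k) p * inv_jacobian j k p) =
      partial i (\<lambda>q. inv_into M \<Gamma> (\<Gamma> q) j) p"
    unfolding inv_jacobian_def
    using partial_compose[OF coordinate_domain_axioms smooth_inv[OF assms(3)] \<Gamma>_in smooth_\<Gamma> assms(1,2)]
    by simp
  also have "\<dots> = partial i (\<lambda>q. q j) p"
    by (rule partial_cong) (use assms inv_\<Gamma> in auto)
  finally show ?thesis by (simp add: partial_coord)
qed

lemma inv_jacobian_right:
  assumes "p \<in> M" "i < 3" "k < 3"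
  shows "(\<Sum>j<3. inv_jacobian j k p * partial j (\<lambda>q. \<Gamma> q i) p) = (if k = i then 1 else 0)"
proof -
  have "(\<Sum>j<3. inv_jacobian j k p * partial j (\<lambda>q. \<Gamma> q i) (inv_into M \<Gamma> (\<Gamma> p))) =
      partial k (\<lambda>q. \<Gamma> (inv_into M \<Gamma> q) i) (\<Gamma> p)"
    unfolding inv_jacobian_def
    using partial_compose[OF coordinate_domain_axioms smooth_\<Gamma>[OF assms(2)] inv_in smooth_inv
        \<Gamma>_in[OF assms(1)] assms(3)]
    by simp
  also have "\<dots> = partial k (\<lambda>q. q i) (\<Gamma> p)"
    by (rule partial_cong) (use assms \<Gamma>_in \<Gamma>_inv in auto)
  finally show ?thesis using inv_\<Gamma>[OF assms(1)] by (simp add: partial_coord)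
qed

text \<open>The Jacobian system determines its solution; this gives uniqueness of the pull-back.\<close>

lemma jacobian_unique:
  assumes "p \<in> M" "\<And>k. k < 3 \<Longrightarrow> (\<Sum>i<3. w i * partial i (\<lambda>q. \<Gamma> q k) p) = v k" "j < 3"
  shows "w j = (\<Sum>k<3. inv_jacobian j k p * v k)"
proof -
  have "(\<Sum>k<3. inv_jacobian j k p * v k) =
      (\<Sum>k<3. \<Sum>i<3. w i * (partial i (\<lambda>q. \<Gamma> q k) p * inv_jacobian j k p))"
    using assms(2)[symmetric] by (intro sum.cong) (auto simp: sum_distrib_left mult_ac)
  also have "\<dots> = (\<Sum>i<3. w i * (\<Sum>k<3. partial i (\<lambda>q. \<Gamma> q k) p * inv_jacobian j k p))"
    by (subst sum.swap) (simp add: sum_distrib_left)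
  also have "\<dots> = (\<Sum>i<3. w i * (if i = j then 1 else 0))"
    using inv_jacobian_left[OF assms(1) _ assms(3)] by (intro sum.cong) auto
  also have "\<dots> = w j" using assms(3) by (simp add: if_distrib cong: if_cong)
  finally show ?thesis by simp
qed

lemma pullback_vf_exists:
  assumes X: "vector_field_on M X"
  shows "\<exists>Z. vector_field_on M Z \<and> (\<forall>p\<in>M. \<forall>i<3. vf_apply Z (\<lambda>q. \<Gamma> q i) p = X (\<Gamma> p) i)"
proof -
  define Z where
    "Z p j = (if p \<in> M \<and> j < 3 then \<Sum>k<3. inv_jacobian j k p * X (\<Gamma> p) k else 0)" for p j
  have "smooth_fun_on 3 M (\<lambda>p. Z p j)" if j: "j < 3" for j
  proof (subst smooth_cong)
    show "Z p j = (\<Sum>k<3. inv_jacobian j k p * X (\<Gamma> p) k)" if "p \<in> M" for p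
      using that j by (simp add: Z_def)
    show "smooth_fun_on 3 M (\<lambda>p. \<Sum>k<3. inv_jacobian j k p * X (\<Gamma> p) k)"
      unfolding inv_jacobian_def
      by (intro smooth_sum smooth_mult smooth_compose[OF coordinate_domain_axioms _ \<Gamma>_in smooth_\<Gamma>]
          smooth_fun_on_partial smooth_inv j vector_field_on_smooth X) auto
  qed
  then have "vector_field_on M Z"
    by (auto simp: vector_field_on_def Z_def fun_eq_iff)
  moreover have "vf_apply Z (\<lambda>q. \<Gamma> q i) p = X (\<Gamma> p) i" if p: "p \<in> M" and i: "i < 3" for p i
  proof -
    have "vf_apply Z (\<lambda>q. \<Gamma> q i) p =
        (\<Sum>j<3. \<Sum>k<3. X (\<Gamma> p) k * (inv_jacobian j k p * partial j (\<lambda>q. \<Gamma> q i) p))"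
      using p by (simp add: vf_apply_def Z_def sum_distrib_left sum_distrib_right mult_ac)
    also have "\<dots> = (\<Sum>k<3. X (\<Gamma> p) k * (\<Sum>j<3. inv_jacobian j k p * partial j (\<lambda>q. \<Gamma> q i) p))"
      by (subst sum.swap) (simp add: sum_distrib_left)
    also have "\<dots> = (\<Sum>k<3. X (\<Gamma> p) k * (if k = i then 1 else 0))"
      using inv_jacobian_right[OF p i] by (intro sum.cong) auto
    also have "\<dots> = X (\<Gamma> p) i" using i by (simp add: if_distrib cong: if_cong)
    finally show ?thesis .
  qed
  ultimately show ?thesis by blast
qed

lemma pullback_vf_unique:
  assumes "vector_field_on M Z" "\<And>p i. p \<in> M \<Longrightarrow> i < 3 \<Longrightarrow> vf_apply Z (\<lambda>q. \<Gamma> q i) p = X (\<Gamma> p) i"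
    "vector_field_on M Z'" "\<And>p i. p \<in> M \<Longrightarrow> i < 3 \<Longrightarrow> vf_apply Z' (\<lambda>q. \<Gamma> q i) p = X (\<Gamma> p) i"
  shows "Z = Z'"
proof (rule vector_field_on_eqI[OF assms(1,3)])
  fix p and j :: nat assume "p \<in> M" "j < 3"
  then show "Z p j = Z' p j"
    using jacobian_unique[of p "Z p" "X (\<Gamma> p)" j] jacobian_unique[of p "Z' p" "X (\<Gamma> p)" j]
      assms(2,4)[of p] unfolding vf_apply_def by simp
qed

lemma pullback_vf:
  assumes "vector_field_on M X"
  shows vector_field_on_pullback: "vector_field_on M (pullback_vf M \<Gamma> X)"
    and vf_apply_pullback:
      "p \<in> M \<Longrightarrow> i < 3 \<Longrightarrow> vf_apply (pullback_vf M \<Gamma> X) (\<lambda>q. \<Gamma> q i) p = X (\<Gamma> p) i"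
proof -
  have "\<exists>!Z. vector_field_on M Z \<and> (\<forall>p\<in>M. \<forall>i<3. vf_apply Z (\<lambda>q. \<Gamma> q i) p = X (\<Gamma> p) i)"
    using pullback_vf_exists[OF assms] pullback_vf_unique by (auto intro!: ex_ex1I)
  from theI'[OF this] show "vector_field_on M (pullback_vf M \<Gamma> X)"
    "p \<in> M \<Longrightarrow> i < 3 \<Longrightarrow> vf_apply (pullback_vf M \<Gamma> X) (\<lambda>q. \<Gamma> q i) p = X (\<Gamma> p) i"
    unfolding pullback_vf_def by auto
qed

lemma pullback_vf_eqI:
  assumes "vector_field_on M X" "vector_field_on M Z"
    "\<And>p i. p \<in> M \<Longrightarrow> i < 3 \<Longrightarrow> vf_apply Z (\<lambda>q. \<Gamma> q i) p = X (\<Gamma> p) i"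
  shows "pullback_vf M \<Gamma> X = Z"
  using pullback_vf[OF assms(1)] assms(2,3) by (intro pullback_vf_unique)

text \<open>\<open>\<Gamma>\<^sup>*X\<close> and \<open>X\<close> are \<open>\<Gamma>\<close>-related: differentiation along them commutes with composition
  with \<open>\<Gamma>\<close>.\<close>

lemma vf_apply_pullback_compose:
  assumes X: "vector_field_on M X" and f: "smooth_fun_on 3 M f" and p: "p \<in> M"
  shows "vf_apply (pullback_vf M \<Gamma> X) (\<lambda>q. f (\<Gamma> q)) p = vf_apply X f (\<Gamma> p)"
  using vf_deriv_compose[OF coordinate_domain_axioms f \<Gamma>_in smooth_\<Gamma> p,
      of "\<lambda>j p. pullback_vf M \<Gamma> X p j"] vf_apply_pullback[OF X p]
  unfolding vf_apply_eq_vf_deriv by (simp add: vf_deriv_def)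

lemma pullback_vf_add:
  assumes "vector_field_on M X" "vector_field_on M Y"
  shows "pullback_vf M \<Gamma> (X + Y) = pullback_vf M \<Gamma> X + pullback_vf M \<Gamma> Y"
proof (rule pullback_vf_eqI)
  fix p and i :: nat assume "p \<in> M" "i < 3"
  then show "vf_apply (pullback_vf M \<Gamma> X + pullback_vf M \<Gamma> Y) (\<lambda>q. \<Gamma> q i) p = (X + Y) (\<Gamma> p) i"
    using vf_apply_pullback[OF assms(1)] vf_apply_pullback[OF assms(2)]
    by (simp add: vf_apply_def ring_distribs sum.distrib)
qed (intro vector_field_on_add vector_field_on_pullback assms)+

lemma pullback_vf_scaleR:
  assumes "vector_field_on M X"
  shows "pullback_vf M \<Gamma> (c *\<^sub>R X) = c *\<^sub>R pullback_vf M \<Gamma> X"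
proof (rule pullback_vf_eqI)
  fix p and i :: nat assume "p \<in> M" "i < 3"
  then show "vf_apply (c *\<^sub>R pullback_vf M \<Gamma> X) (\<lambda>q. \<Gamma> q i) p = (c *\<^sub>R X) (\<Gamma> p) i"
    using vf_apply_pullback[OF assms]
    by (simp add: vf_apply_def scaleR_fun_def mult.assoc flip: sum_distrib_left)
qed (intro vector_field_on_scaleR vector_field_on_pullback assms)+

text \<open>Apply both sides to the components of \<open>\<Gamma>\<close>.  As \<open>\<Gamma>\<close>-relatedness can be iterated,
  $\hat X\hat Y(\Gamma_i) = (X Y_i)\circ\Gamma$, and the commutator of vector fields is the commutator of the
  derivations.\<close>

lemma pullback_vf_commutator:
  assumes X: "vector_field_on M X" and Y: "vector_field_on M Y"
  shows "pullback_vf M \<Gamma> (commutator X Y) = commutator (pullback_vf M \<Gamma> X) (pullback_vf M \<Gamma> Y)"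
proof (rule pullback_vf_eqI)
  fix p and i :: nat assume p: "p \<in> M" and i: "i < 3"
  have iterate: "vf_apply (pullback_vf M \<Gamma> V) (vf_apply (pullback_vf M \<Gamma> W) (\<lambda>q. \<Gamma> q i)) p =
      vf_apply V (\<lambda>q. W q i) (\<Gamma> p)" if V: "vector_field_on M V" and W: "vector_field_on M W" for V W
  proof -
    have "vf_apply (pullback_vf M \<Gamma> V) (vf_apply (pullback_vf M \<Gamma> W) (\<lambda>q. \<Gamma> q i)) p =
      vf_apply (pullback_vf M \<Gamma> V) (\<lambda>q. W (\<Gamma> q) i) p"
      unfolding vf_apply_eq_vf_deriv[of "pullback_vf M \<Gamma> V"]
      by (rule vf_deriv_cong[OF _ p]) (rule vf_apply_pullback[OF W _ i])
    then show ?thesis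
      using vf_apply_pullback_compose[OF V vector_field_on_smooth[OF W i] p] by simp
  qed
  show "vf_apply (commutator (pullback_vf M \<Gamma> X) (pullback_vf M \<Gamma> Y)) (\<lambda>q. \<Gamma> q i) p =
      commutator X Y (\<Gamma> p) i"
    using vf_deriv_commute[where a = "\<lambda>j p. pullback_vf M \<Gamma> X p j" and
        b = "\<lambda>j p. pullback_vf M \<Gamma> Y p j", OF vector_field_on_smooth[OF vector_field_on_pullback[OF X]]
        vector_field_on_smooth[OF vector_field_on_pullback[OF Y]] smooth_\<Gamma>[OF i] p]
      iterate[OF X Y] iterate[OF Y X]
    unfolding commutator_def[of X Y] vf_apply_def[of "commutator _ _"]
    unfolding commutator_def vf_apply_eq_vf_deriv by simp
qed (intro vector_field_on_commutator vector_field_on_pullback X Y)+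

lemma pullback_vf_inject:
  assumes X: "vector_field_on M X" and Y: "vector_field_on M Y"
    and eq: "pullback_vf M \<Gamma> X = pullback_vf M \<Gamma> Y"
  shows "X = Y"
proof (rule vector_field_on_eqI[OF X Y])
  fix p and i :: nat assume "p \<in> M" "i < 3"
  then show "X p i = Y p i"
    using vf_apply_pullback[OF X inv_in, of p i] vf_apply_pullback[OF Y inv_in, of p i] eq \<Gamma>_inv
    by simp
qed

end

section \<open>Contact transformations act on contact vector fields\<close>

locale base_contact = coordinate_domain 3 M for M +
  fixes \<Gamma> :: "point \<Rightarrow> point"
  assumes contact: "contact_transformation M \<Gamma>"

sublocale base_contact \<subseteq> base_diffeo
  using contact by unfold_locales (simp add: contact_transformation_def)

text \<open>The index 1 names the coordinate \<open>y\<close> and has to remain a numeral, like 0 and 2.\<close>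

declare One_nat_def [simp del]

context base_contact begin

abbreviation "xh \<equiv> \<lambda>p. \<Gamma> p 0"
abbreviation "yh \<equiv> \<lambda>p. \<Gamma> p 1"
abbreviation "zh \<equiv> \<lambda>p. \<Gamma> p 2"

lemma smooth_hat: "smooth_fun_on 3 M xh" "smooth_fun_on 3 M yh" "smooth_fun_on 3 M zh"
  by (auto intro: smooth_\<Gamma>)

text \<open>\<open>\<Gamma>\<close> pulls the contact form $dy - y'\,dx$ back to a multiple of itself; this is the factor.\<close>

definition conformal_factor :: "point \<Rightarrow> real"
  where "conformal_factor p = partial 1 yh p - zh p * partial 1 xh p"

lemma smooth_conformal_factor: "smooth_fun_on 3 M conformal_factor"
  unfolding conformal_factor_def[abs_def] by (intro smooth_intros smooth_fun_on_partial smooth_hat) auto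

text \<open>$\Gamma^*\theta = \lambda\theta$ in components.\<close>

lemma contact_form_pullback:
  assumes "p \<in> M"
  shows "partial 0 yh p = zh p * partial 0 xh p - conformal_factor p * p 2"
    and "partial 1 yh p = zh p * partial 1 xh p + conformal_factor p"
    and "partial 2 yh p = zh p * partial 2 xh p"
proof -
  have "partial 0 yh p + p 2 * partial 1 yh p = (partial 0 xh p + p 2 * partial 1 xh p) * zh p"
    "partial 2 yh p = partial 2 xh p * zh p"
    using contact assms by (auto simp: contact_transformation_def Let_def)
  then show "partial 0 yh p = zh p * partial 0 xh p - conformal_factor p * p 2"
    "partial 1 yh p = zh p * partial 1 xh p + conformal_factor p"
    "partial 2 yh p = zh p * partial 2 xh p"
    by (auto simp: conformal_factor_def algebra_simps)
qed

text \<open>At a zero of the factor the differential of \<open>yh\<close> would be a multiple of that of \<open>xh\<close>, and the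
  Jacobian would be singular.\<close>

lemma conformal_factor_nonzero:
  assumes p: "p \<in> M"
  shows "conformal_factor p \<noteq> 0"
proof
  assume "conformal_factor p = 0"
  have "partial j yh p = zh p * partial j xh p" if "j < 3" for j
  proof -
    from that consider "j = 0" | "j = 1" | "j = 2" by linarith
    then show ?thesis using contact_form_pullback[OF p] \<open>conformal_factor p = 0\<close> by cases simp_all
  qed
  then have "(\<Sum>j<3. inv_jacobian j 1 p * partial j yh p) =
      zh p * (\<Sum>j<3. inv_jacobian j 1 p * partial j xh p)"
    by (simp add: sum_distrib_left mult_ac)
  then show False using inv_jacobian_right[OF p, of _ 1] by simp
qed

text \<open>The three components of $\Gamma^*d\theta = d(\lambda\theta)$ for $\theta = dy - y'\,dx$, obtained by
  differentiating the relations above once more.\<close>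

lemma contact_form_derivative_pullback:
  assumes p: "p \<in> M"
  shows "partial 1 zh p * partial 0 xh p - partial 0 zh p * partial 1 xh p =
      partial 0 conformal_factor p + p 2 * partial 1 conformal_factor p"
    and "partial 2 zh p * partial 0 xh p - partial 0 zh p * partial 2 xh p =
      conformal_factor p + p 2 * partial 2 conformal_factor p"
    and "partial 2 zh p * partial 1 xh p - partial 1 zh p * partial 2 xh p =
      - partial 2 conformal_factor p"
proof -
  let ?l = conformal_factor
  note sm = smooth_hat smooth_conformal_factor smooth_fun_on_partial smooth_intros
  have d0: "partial j (partial 0 yh) p = partial j zh p * partial 0 xh p + zh p * partial j (partial 0 xh) p
      - (partial j ?l p * p 2 + ?l p * (if j = 2 then 1 else 0))" if "j < 3" for j
  proof -
    have "partial j (partial 0 yh) p = partial j (\<lambda>p. zh p * partial 0 xh p - ?l p * p 2) p"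
      by (rule partial_cong[OF _ p that]) (rule contact_form_pullback)
    also have "\<dots> = partial j (\<lambda>p. zh p * partial 0 xh p) p - partial j (\<lambda>p. ?l p * p 2) p"
      by (rule partial_diff) (use p that in \<open>auto intro!: sm\<close>)
    also have "partial j (\<lambda>p. zh p * partial 0 xh p) p = partial j zh p * partial 0 xh p + zh p * partial j (partial 0 xh) p"
      by (rule partial_mult) (use p that in \<open>auto intro!: sm\<close>)
    also have "partial j (\<lambda>p. ?l p * p 2) p = partial j ?l p * p 2 + ?l p * partial j (\<lambda>p. p 2) p"
      by (rule partial_mult) (use p that in \<open>auto intro!: sm\<close>)
    finally show ?thesis by (simp add: partial_coord)
  qed
  have d1: "partial j (partial 1 yh) p = partial j zh p * partial 1 xh p + zh p * partial j (partial 1 xh) p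
      + partial j ?l p" if "j < 3" for j
  proof -
    have "partial j (partial 1 yh) p = partial j (\<lambda>p. zh p * partial 1 xh p + ?l p) p"
      by (rule partial_cong[OF _ p that]) (rule contact_form_pullback)
    also have "\<dots> = partial j (\<lambda>p. zh p * partial 1 xh p) p + partial j ?l p"
      by (rule partial_add) (use p that in \<open>auto intro!: sm\<close>)
    also have "partial j (\<lambda>p. zh p * partial 1 xh p) p = partial j zh p * partial 1 xh p + zh p * partial j (partial 1 xh) p"
      by (rule partial_mult) (use p that in \<open>auto intro!: sm\<close>)
    finally show ?thesis .
  qed
  have d2: "partial j (partial 2 yh) p = partial j zh p * partial 2 xh p + zh p * partial j (partial 2 xh) p"
    if "j < 3" for j
  proof -
    have "partial j (partial 2 yh) p = partial j (\<lambda>p. zh p * partial 2 xh p) p"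
      by (rule partial_cong[OF _ p that]) (rule contact_form_pullback)
    also have "\<dots> = partial j zh p * partial 2 xh p + zh p * partial j (partial 2 xh) p"
      by (rule partial_mult) (use p that in \<open>auto intro!: sm\<close>)
    finally show ?thesis .
  qed
  note comm = smooth_hat(1)[THEN partial_commute, OF p] smooth_hat(2)[THEN partial_commute, OF p]
  have c: "partial 0 (partial 1 f) p = partial 1 (partial 0 f) p"
     "partial 0 (partial 2 f) p = partial 2 (partial 0 f) p"
     "partial 1 (partial 2 f) p = partial 2 (partial 1 f) p" if "f = xh \<or> f = yh" for f
    using comm that by auto
  show "partial 1 zh p * partial 0 xh p - partial 0 zh p * partial 1 xh p =
      partial 0 ?l p + p 2 * partial 1 ?l p"
    using d0[of 1] d1[of 0] c(1)[of xh] c(1)[of yh] by (simp add: algebra_simps)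
  show "partial 2 zh p * partial 0 xh p - partial 0 zh p * partial 2 xh p =
      ?l p + p 2 * partial 2 ?l p"
    using d0[of 2] d2[of 0] c(2)[of xh] c(2)[of yh] by (simp add: algebra_simps)
  show "partial 2 zh p * partial 1 xh p - partial 1 zh p * partial 2 xh p = - partial 2 ?l p"
    using d1[of 2] d2[of 1] c(3)[of xh] c(3)[of yh] by (simp add: algebra_simps)
qed

end

text \<open>How a generator in \<^const>\<open>contact_generators\<close> is determined by its characteristic function; these
  relations do not involve the equation.\<close>

definition contact_characteristic :: "point set \<Rightarrow> (point \<Rightarrow> point) \<Rightarrow> (point \<Rightarrow> real) \<Rightarrow> bool"
  where "contact_characteristic M X Q \<longleftrightarrow> smooth_fun_on 3 M Q \<and>
    (\<forall>p\<in>M. X p 0 = - partial 2 Q p \<and> X p 1 = Q p - p 2 * partial 2 Q p \<and>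
             X p 2 = partial 0 Q p + p 2 * partial 1 Q p)"

context base_contact begin

text \<open>Here $\hat Q = \theta(\hat X)$.  Contracting $\Gamma^*\theta = \lambda\theta$ with $\hat X$ gives
  $\lambda\hat Q = Q\circ\Gamma$.  Differentiating this relation, the derivatives of \<open>Q\<close> turn into components of
  \<open>X\<close> at \<open>\<Gamma> p\<close>, i.e. into $\hat X$ applied to \<open>\<Gamma>\<close>, and $\Gamma^*d\theta = d(\lambda\theta)$ eliminates the
  derivatives of \<open>\<Gamma>\<close>.  Everything is then divisible by $\lambda$.\<close>

lemma contact_characteristic_pullback:
  assumes X: "vector_field_on M X" and Q: "contact_characteristic M X Q"
  defines "Z \<equiv> pullback_vf M \<Gamma> X"
  shows "contact_characteristic M Z (\<lambda>p. Z p 1 - p 2 * Z p 0)"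
proof -
  let ?l = conformal_factor
  define Qh where "Qh = (\<lambda>p. Z p 1 - p 2 * Z p 0)"
  have Z: "vector_field_on M Z" unfolding Z_def by (rule vector_field_on_pullback[OF X])
  have Qs: "smooth_fun_on 3 M Q"
    and Q0: "\<And>p. p \<in> M \<Longrightarrow> X p 0 = - partial 2 Q p"
    and Q1: "\<And>p. p \<in> M \<Longrightarrow> X p 1 = Q p - p 2 * partial 2 Q p"
    and Q2: "\<And>p. p \<in> M \<Longrightarrow> X p 2 = partial 0 Q p + p 2 * partial 1 Q p"
    using Q by (auto simp: contact_characteristic_def)
  have Qhs: "smooth_fun_on 3 M Qh"
    unfolding Qh_def by (intro smooth_intros vector_field_on_smooth Z) auto
  have ZG: "Z p 0 * partial 0 (\<lambda>q. \<Gamma> q i) p + Z p 1 * partial 1 (\<lambda>q. \<Gamma> q i) p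
      + Z p 2 * partial 2 (\<lambda>q. \<Gamma> q i) p = X (\<Gamma> p) i" if "p \<in> M" "i < 3" for p i
    using vf_apply_pullback[OF X that] unfolding Z_def[symmetric] vf_apply_def sum_lessThan_3 .
  have lQ: "?l p * Qh p = Q (\<Gamma> p)" if p: "p \<in> M" for p
  proof -
    have "Q (\<Gamma> p) = X (\<Gamma> p) 1 - \<Gamma> p 2 * X (\<Gamma> p) 0"
      using Q0[OF \<Gamma>_in[OF p]] Q1[OF \<Gamma>_in[OF p]] by simp
    then show ?thesis
      using ZG[OF p, of 1] ZG[OF p, of 0] contact_form_pullback[OF p]
      unfolding Qh_def by simp algebra
  qed
  have dlQ: "partial i ?l p * Qh p + ?l p * partial i Qh p =
      partial i xh p * partial 0 Q (\<Gamma> p) + partial i yh p * partial 1 Q (\<Gamma> p)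
      + partial i zh p * partial 2 Q (\<Gamma> p)" if p: "p \<in> M" and i: "i < 3" for p i
  proof -
    have "partial i (\<lambda>p. ?l p * Qh p) p = partial i (\<lambda>p. Q (\<Gamma> p)) p"
      by (rule partial_cong[OF lQ p i])
    then show ?thesis
      using partial_mult[OF smooth_conformal_factor Qhs p i]
        partial_compose[OF coordinate_domain_axioms Qs \<Gamma>_in smooth_\<Gamma> p i]
      by (simp add: sum_lessThan_3)
  qed
  have "Z p 0 = - partial 2 Qh p \<and> Z p 1 = Qh p - p 2 * partial 2 Qh p \<and>
        Z p 2 = partial 0 Qh p + p 2 * partial 1 Qh p" if p: "p \<in> M" for p
  proof -
    note d = dlQ[OF p, of 0] dlQ[OF p, of 1] dlQ[OF p, of 2]
    note c = contact_form_pullback[OF p] contact_form_derivative_pullback[OF p]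
    note x = ZG[OF p, of 0] ZG[OF p, of 2] Q0[OF \<Gamma>_in[OF p]] Q2[OF \<Gamma>_in[OF p]]
    have Qp: "Qh p = Z p 1 - p 2 * Z p 0" by (simp add: Qh_def)
    have "?l p * (Z p 0) = ?l p * (- partial 2 Qh p)"
      using d(3) c x Qp by simp algebra
    then have z0: "Z p 0 = - partial 2 Qh p"
      unfolding mult_left_cancel[OF conformal_factor_nonzero[OF p]] .
    have "?l p * (Z p 2) = ?l p * (partial 0 Qh p + p 2 * partial 1 Qh p)"
      using d(1,2) c x Qp by simp algebra
    then have "Z p 2 = partial 0 Qh p + p 2 * partial 1 Qh p"
      unfolding mult_left_cancel[OF conformal_factor_nonzero[OF p]] .
    then show ?thesis using z0 Qp by simp
  qed
  then show ?thesis using Qhs unfolding contact_characteristic_def Qh_def by blast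
qed

text \<open>On the contact plane at \<open>p\<close>, spanned by $\partial_x + y'\partial_y$ and $\partial_{y'}$, the differentials
  of \<open>xh\<close> and \<open>zh\<close> are linearly independent: a vector of the plane on which both vanish is annihilated by the differential
  of \<open>yh\<close> too, hence by the Jacobian.\<close>

lemma contact_plane_nondegenerate:
  assumes p: "p \<in> M" and "a \<noteq> 0 \<or> b \<noteq> 0"
    and x: "a * (partial 0 xh p + p 2 * partial 1 xh p) + b * partial 2 xh p = 0"
  shows "a * (partial 0 zh p + p 2 * partial 1 zh p) + b * partial 2 zh p \<noteq> 0"
proof
  assume z: "a * (partial 0 zh p + p 2 * partial 1 zh p) + b * partial 2 zh p = 0"
  define w where "w j = (if j = 0 then a else if j = 1 then a * p 2 else b)" for j :: nat
  have w: "w 0 = a" "w 1 = a * p 2" "w 2 = b" by (simp_all add: w_def)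
  have y: "a * (partial 0 yh p + p 2 * partial 1 yh p) + b * partial 2 yh p = 0"
    using x contact_form_pullback[OF p] by simp algebra
  have "(\<Sum>i<3. w i * partial i (\<lambda>q. \<Gamma> q k) p) = 0" if "k < 3" for k
  proof -
    from that consider "k = 0" | "k = 1" | "k = 2" by linarith
    then show ?thesis using x y z by cases (simp_all add: sum_lessThan_3 w algebra_simps)
  qed
  then have "w j = 0" if "j < 3" for j
    using jacobian_unique[OF p _ that, of w "\<lambda>_. 0"] by simp
  from this[of 0] this[of 2] w assms(2) show False by simp
qed

end

section \<open>Functions on jet spaces and the total derivative\<close>

declare add_2_eq_Suc [simp del] add_2_eq_Suc' [simp del]

lemma jet_proj_jet_proj: "jet_proj k (jet_proj l p) = jet_proj (min k l) p"
  by (auto simp: jet_proj_def fun_eq_iff)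

lemma jet_proj_apply: "i \<le> k + 1 \<Longrightarrow> jet_proj k p i = p i"
  by (simp add: jet_proj_def)

lemma jet_proj_upd: "i \<le> k + 1 \<Longrightarrow> jet_proj k (p(i := t)) = (jet_proj k p)(i := t)"
  and jet_proj_upd_beyond: "i > k + 1 \<Longrightarrow> jet_proj k (p(i := t)) = jet_proj k p"
  by (auto simp: jet_proj_def fun_eq_iff)

lemma jet_proj_Euclidean_space: "m \<le> k + 2 \<Longrightarrow> p \<in> topspace (Euclidean_space m) \<Longrightarrow> jet_proj k p = p"
  by (auto simp: jet_proj_def topspace_Euclidean_space fun_eq_iff)

text \<open>A function on $J^k$ is represented as a function on sequences that ignores the later coordinates;
  this makes it a function on every higher jet space as well.\<close>

definition jet_order :: "nat \<Rightarrow> (point \<Rightarrow> real) \<Rightarrow> bool"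
  where "jet_order k f \<longleftrightarrow> (\<forall>p. f (jet_proj k p) = f p)"

lemma jet_orderD: "jet_order k f \<Longrightarrow> f (jet_proj k p) = f p"
  by (simp add: jet_order_def)

lemma jet_order_mono:
  assumes "jet_order k f" "k \<le> l" shows "jet_order l f"
  unfolding jet_order_def
proof
  fix p
  show "f (jet_proj l p) = f p"
    using jet_orderD[OF assms(1), of "jet_proj l p"] jet_orderD[OF assms(1), of p] assms(2)
    by (simp add: jet_proj_jet_proj min_absorb1)
qed

lemma jet_order_jet_proj: "k \<le> l \<Longrightarrow> jet_order l (\<lambda>p. f (jet_proj k p))"
  by (simp add: jet_order_def jet_proj_jet_proj min_absorb1)

lemma partial_beyond_jet_order:
  assumes "jet_order k f" "i > k + 1" shows "partial i f p = 0"
proof -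
  have "f (p(i := t)) = f p" for t
    using jet_orderD[OF assms(1), of "p(i := t)"] jet_orderD[OF assms(1), of p] assms(2)
    by (simp add: jet_proj_upd_beyond)
  then show ?thesis by (simp add: partial_def)
qed

lemma partial_jet_proj: "i \<le> k + 1 \<Longrightarrow> partial i (\<lambda>q. f (jet_proj k q)) p = partial i f (jet_proj k p)"
  by (simp add: partial_def jet_proj_upd jet_proj_apply)

lemma jet_order_partial:
  assumes "jet_order k f" shows "jet_order k (partial i f)"
proof (cases "i \<le> k + 1")
  case True
  have "(\<lambda>q. f (jet_proj k q)) = f" using jet_orderD[OF assms] by auto
  then show ?thesis using partial_jet_proj[OF True, of f] by (simp add: jet_order_def)
next
  case False
  then show ?thesis using partial_beyond_jet_order[OF assms] by (simp add: jet_order_def)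
qed

text \<open>The components of the total derivative \<open>D\<close> as a vector field.  On \<^term>\<open>Euclidean_space m\<close> the
  last component reads coordinate \<open>m\<close>, which vanishes; on functions of order less than $m-2$, which ignore the last
  coordinate, the derivation of $J^{m-2}$ with these components is the total derivative.\<close>

definition total_vf :: "nat \<Rightarrow> point \<Rightarrow> real"
  where "total_vf i p = (if i = 0 then 1 else p (i + 1))"

lemma total_vf_Suc: "total_vf (Suc i) p = p (i + 2)"
  by (simp add: total_vf_def One_nat_def add_2_eq_Suc')

lemma total_deriv_eq_vf_deriv:
  assumes f: "jet_order k f" and m: "k + 2 \<le> m"
  shows "total_deriv k f p = vf_deriv m total_vf f p"
proof -
  have "vf_deriv m total_vf f p = (\<Sum>i<k+2. total_vf i p * partial i f p)"
    unfolding vf_deriv_def using m partial_beyond_jet_order[OF f]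
    by (intro sum.mono_neutral_right) auto
  also have "{..<k+2} = insert 0 {1..k+1}" by auto
  also have "(\<Sum>i\<in>insert 0 {1..k+1}. total_vf i p * partial i f p) =
      partial 0 f p + (\<Sum>i=1..k+1. p (i + 1) * partial i f p)"
    by (subst sum.insert) (auto simp: total_vf_def intro!: sum.cong)
  finally show ?thesis
    using jet_orderD[OF jet_order_partial[OF f]] by (simp add: total_deriv_def)
qed

lemma total_deriv_jet_proj: "total_deriv k (\<lambda>q. f (jet_proj k q)) = total_deriv k f"
  by (auto simp: total_deriv_def fun_eq_iff partial_jet_proj jet_proj_jet_proj intro!: sum.cong)

lemma jet_order_total_deriv: "jet_order (Suc k) (total_deriv k f)"
  by (auto simp: jet_order_def total_deriv_def jet_proj_jet_proj jet_proj_apply min_absorb1 intro!: sum.cong)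

text \<open>Only the last term of the total derivative contains $y^{(k+1)}$, as a factor.\<close>

lemma total_deriv_upd_top:
  "total_deriv k f (p(k + 2 := t)) = total_deriv k f p + (t - p (k + 2)) * partial (k + 1) f (jet_proj k p)"
proof -
  have *: "{1..k+1} = insert (k + 1) {1..k}" by auto
  have "total_deriv k f (p(k + 2 := s)) =
      partial 0 f (jet_proj k p) + (\<Sum>i=1..k. p (i + 1) * partial i f (jet_proj k p))
      + s * partial (k + 1) f (jet_proj k p)" for s
    unfolding total_deriv_def * by (subst sum.insert) (auto simp: jet_proj_upd_beyond)
  from this[of t] this[of "p (k + 2)"] show ?thesis by (simp add: algebra_simps)
qed

lemma partial_total_deriv_top: "partial (k + 2) (total_deriv k f) p = partial (k + 1) f (jet_proj k p)"
proof -
  have "((\<lambda>t. total_deriv k f (p(k + 2 := t))) has_real_derivative partial (k + 1) f (jet_proj k p))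
      (at (p (k + 2)))"
    unfolding total_deriv_upd_top by (auto intro!: derivative_eq_intros)
  then show ?thesis unfolding partial_def by (rule DERIV_imp_deriv)
qed

lemma jet_order_total_deriv_pow: "jet_order (Suc k) (total_deriv_pow k Q)"
proof (cases k)
  case 0
  then show ?thesis using jet_order_jet_proj[of 1 "Suc 0" Q] by (simp add: jet_order_def)
next
  case (Suc j)
  then show ?thesis using jet_order_total_deriv[of "Suc j" "total_deriv_pow j Q"] by (simp add: jet_order_def)
qed

lemma partial_total_deriv_pow_top:
  "partial (k + 2) (total_deriv_pow k Q) p = partial 2 Q (jet_proj 1 p)"
proof (induction k arbitrary: p)
  case 0
  have "total_deriv_pow 0 Q = (\<lambda>p. Q (jet_proj 1 p))" by auto
  then show ?case using partial_jet_proj[of 2 1 Q p] by simp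
next
  case (Suc k)
  have "total_deriv_pow (Suc k) Q = total_deriv (Suc k) (total_deriv_pow k Q)" by auto
  then show ?case
    using Suc[of "jet_proj (Suc k) p"] partial_total_deriv_top[of "Suc k" "total_deriv_pow k Q" p]
    by (simp add: jet_proj_jet_proj add_2_eq_Suc' One_nat_def)
qed

text \<open>In $D^kQ - y^{(k+1)}Q_{y'}$ the highest derivative cancels: by induction, the coefficient of
  $y^{(k+1)}$ in $D^kQ$ is $Q_{y'}$.  For $k = 0$ the order is 1, because $Q$ itself depends on $y'$.\<close>

lemma jet_order_eta_k:
  assumes "k \<ge> 1" shows "jet_order k (eta_k Q k)"
  unfolding jet_order_def
proof
  fix p
  obtain j where j: "k = Suc j" using assms by (cases k) auto
  let ?F = "total_deriv_pow j Q"
  have "(jet_proj k p)(k + 2 := p (k + 2)) = jet_proj (Suc k) p"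
    by (auto simp: jet_proj_def fun_eq_iff)
  then have "total_deriv k ?F (jet_proj (Suc k) p) = total_deriv k ?F (jet_proj k p)
      + (p (k + 2) - jet_proj k p (k + 2)) * partial (k + 1) ?F (jet_proj k (jet_proj k p))"
    using total_deriv_upd_top[of k ?F "jet_proj k p" "p (k + 2)"] by simp
  moreover have "total_deriv k ?F (jet_proj (Suc k) p) = total_deriv k ?F p"
    by (rule jet_orderD[OF jet_order_total_deriv])
  moreover have "partial (k + 1) ?F (jet_proj k (jet_proj k p)) = partial 2 Q (jet_proj 1 p)"
  proof -
    have "k + 1 = j + 2" using j by simp
    then show ?thesis using partial_total_deriv_pow_top[of j Q] assms
      by (simp add: jet_proj_jet_proj min_absorb1 add_2_eq_Suc' One_nat_def j)
  qed
  moreover have "jet_proj k p (k + 2) = 0" by (simp add: jet_proj_def)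
  ultimately show "eta_k Q k (jet_proj k p) = eta_k Q k p"
    using j assms by (simp add: eta_k_def jet_proj_jet_proj min_absorb1)
qed

lemma jet_order_divide: "jet_order k f \<Longrightarrow> jet_order k g \<Longrightarrow> jet_order k (\<lambda>p. f p / g p)"
  by (simp add: jet_order_def)

lemma jet_order_D_xhat: "jet_order 2 (D_xhat \<Gamma>)"
  using jet_order_total_deriv[of 1] by (simp add: numeral_2_eq_2)

lemma jet_order_yhat: "jet_order (max 1 k) (yhat \<Gamma> k)"
proof (induction \<Gamma> k "undefined :: point" rule: yhat.induct)
  case (1 \<Gamma>)
  then show ?case by (auto simp: jet_order_def jet_proj_jet_proj)
next
  case (2 \<Gamma>)
  then show ?case by (auto simp: jet_order_def jet_proj_jet_proj)
next
  case (3 \<Gamma> k)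
  have "jet_order (Suc (Suc k)) (\<lambda>p. total_deriv (Suc k) (yhat \<Gamma> (Suc k)) p / D_xhat \<Gamma> p)"
    by (intro jet_order_divide jet_order_total_deriv jet_order_mono[OF jet_order_D_xhat]) simp
  moreover have "yhat \<Gamma> (Suc (Suc k)) = (\<lambda>p. total_deriv (Suc k) (yhat \<Gamma> (Suc k)) p / D_xhat \<Gamma> p)"
    by auto
  ultimately show ?case by (simp only: max_def) simp
qed

lemma eta_k_0: "eta_k Q 0 p = Q (jet_proj 1 p) - p 2 * partial 2 Q (jet_proj 1 p)"
  by (simp add: eta_k_def)

lemma eta_k_1: "eta_k Q 1 p = partial 0 Q (jet_proj 1 p) + p 2 * partial 1 Q (jet_proj 1 p)"
proof -
  have "total_deriv_pow 0 Q = (\<lambda>p. Q (jet_proj 1 p))" by auto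
  moreover have "total_deriv_pow 1 Q p = total_deriv 1 (total_deriv_pow 0 Q) p"
    unfolding One_nat_def by simp
  ultimately have "total_deriv_pow 1 Q p = total_deriv 1 Q p"
    by (simp add: total_deriv_jet_proj)
  moreover have "{1..1+1} = {1, 2::nat}" by auto
  ultimately show ?thesis by (simp add: eta_k_def total_deriv_def)
qed

subsection \<open>Open subsets of jet spaces\<close>

lemma smooth_fun_on_subset: "smooth_fun_on m U f \<Longrightarrow> V \<subseteq> U \<Longrightarrow> smooth_fun_on m V f"
  unfolding smooth_fun_on_def by (meson continuous_on_subset subsetD)

context coordinate_domain begin

lemma smooth_jet_proj: "smooth_fun_on m U (\<lambda>p. jet_proj k p i)"
  by (cases "i \<le> k + 1") (auto simp: jet_proj_def intro: smooth_intros)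

lemma coordinate_domain_preimage:
  assumes V: "openin (Euclidean_space l) V" and g: "continuous_on U g"
    "\<And>p. p \<in> U \<Longrightarrow> g p \<in> topspace (Euclidean_space l)"
  shows "coordinate_domain m {p \<in> U. g p \<in> V}"
proof
  obtain T where T: "open T" "V = T \<inter> {x. \<forall>i\<ge>l. x i = 0}"
    using V unfolding Euclidean_space_def euclidean_product_topology openin_subtopology
    by auto
  have "openin (top_of_set U) (U \<inter> g -` T)"
    by (rule continuous_openin_preimage_gen[OF g(1) T(1)])
  moreover have "U \<inter> g -` T = {p \<in> U. g p \<in> V}"
    using g(2) T(2) by (auto simp: topspace_Euclidean_space)
  ultimately show "openin (Euclidean_space m) {p \<in> U. g p \<in> V}"
    using open_dom openin_trans unfolding Euclidean_space_def euclidean_product_topology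
    by (metis (lifting))
qed

lemma coordinate_domain_nonzero:
  assumes g: "continuous_on U (g :: point \<Rightarrow> real)"
  shows "coordinate_domain m {p \<in> U. g p \<noteq> 0}"
proof
  have "openin (top_of_set U) (U \<inter> g -` (- {0}))"
    by (rule continuous_openin_preimage_gen[OF g]) auto
  moreover have "U \<inter> g -` (- {0}) = {p \<in> U. g p \<noteq> 0}" by auto
  ultimately show "openin (Euclidean_space m) {p \<in> U. g p \<noteq> 0}"
    using open_dom openin_trans unfolding Euclidean_space_def euclidean_product_topology
    by (metis (lifting))
qed

end

text \<open>The components of the infinite prolongation of the contact vector field with
  characteristic \<open>Q\<close>.\<close>

definition prolonged_vf :: "(point \<Rightarrow> real) \<Rightarrow> nat \<Rightarrow> point \<Rightarrow> real"
  where "prolonged_vf Q i = (if i = 0 then (\<lambda>p. - partial 2 Q (jet_proj 1 p)) else eta_k Q (i - 1))"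

lemma prolonged_vf_0: "prolonged_vf Q 0 = (\<lambda>p. - partial 2 Q (jet_proj 1 p))"
  and prolonged_vf_Suc: "prolonged_vf Q (Suc k) = eta_k Q k"
  by (simp_all add: prolonged_vf_def)

text \<open>An open set \<open>W\<close> of $J^{m-2}$ lying over the open set \<open>M\<close> of $J^1$.\<close>

locale jet_domain = coordinate_domain m W + base: coordinate_domain 3 M
  for m W M +
  assumes proj_in: "p \<in> W \<Longrightarrow> jet_proj 1 p \<in> M"
begin

lemma smooth_lift: "smooth_fun_on 3 M f \<Longrightarrow> smooth_fun_on m W (\<lambda>p. f (jet_proj 1 p))"
  by (rule smooth_compose[OF base.coordinate_domain_axioms _ proj_in smooth_jet_proj])

lemma smooth_total_vf: "smooth_fun_on m W (total_vf i)"
  unfolding total_vf_def[abs_def] by (cases "i = 0") (auto intro: smooth_intros)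

abbreviation "D \<equiv> vf_deriv m total_vf"

lemma smooth_D: "smooth_fun_on m W f \<Longrightarrow> smooth_fun_on m W (D f)"
  by (intro smooth_vf_deriv smooth_total_vf)

lemma total_deriv_eq_D: "jet_order k f \<Longrightarrow> k + 2 \<le> m \<Longrightarrow> total_deriv k f = D f"
  by (rule ext) (rule total_deriv_eq_vf_deriv)

lemma total_deriv_pow_Suc: "k + 3 \<le> m \<Longrightarrow> total_deriv_pow (Suc k) Q = D (total_deriv_pow k Q)"
  using total_deriv_eq_D[OF jet_order_total_deriv_pow[of k Q]] by (auto simp: fun_eq_iff)

lemma smooth_total_deriv_pow:
  assumes "smooth_fun_on 3 M Q" shows "k + 2 \<le> m \<Longrightarrow> smooth_fun_on m W (total_deriv_pow k Q)"
proof (induction k)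
  case 0
  have "total_deriv_pow 0 Q = (\<lambda>p. Q (jet_proj 1 p))" by auto
  then show ?case using smooth_lift[OF assms] by simp
next
  case (Suc k)
  then show ?case by (subst total_deriv_pow_Suc) (auto intro: smooth_D)
qed

lemma smooth_eta_k:
  assumes "smooth_fun_on 3 M Q" "k + 2 \<le> m" shows "smooth_fun_on m W (eta_k Q k)"
  unfolding eta_k_def[abs_def]
  by (intro smooth_intros smooth_total_deriv_pow assms smooth_lift smooth_fun_on_partial) simp

lemma smooth_xi: "smooth_fun_on 3 M Q \<Longrightarrow> smooth_fun_on m W (prolonged_vf Q 0)"
  unfolding prolonged_vf_0 by (intro smooth_intros smooth_lift smooth_fun_on_partial) auto

lemma smooth_prolonged_vf:
  "smooth_fun_on 3 M Q \<Longrightarrow> i < m \<Longrightarrow> smooth_fun_on m W (prolonged_vf Q i)"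
  by (cases i) (auto simp: prolonged_vf_Suc intro: smooth_xi smooth_eta_k)

text \<open>The classical prolongation formula.\<close>

lemma eta_k_Suc:
  assumes Q: "smooth_fun_on 3 M Q" and k: "k + 2 < m" and p: "p \<in> W"
  shows "eta_k Q (Suc k) p = D (eta_k Q k) p - p (k + 2) * D (prolonged_vf Q 0) p"
proof -
  let ?q = "\<lambda>p. partial 2 Q (jet_proj 1 p)"
  have q: "smooth_fun_on m W ?q" by (intro smooth_lift smooth_fun_on_partial Q) simp
  have "eta_k Q k = (\<lambda>p. total_deriv_pow k Q p - p (k + 2) * ?q p)"
    by (simp add: eta_k_def fun_eq_iff)
  then have "D (eta_k Q k) p = D (\<lambda>p. total_deriv_pow k Q p - p (k + 2) * ?q p) p" by simp
  also have "\<dots> = D (total_deriv_pow k Q) p - D (\<lambda>p. p (k + 2) * ?q p) p"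
    by (intro vf_deriv_diff smooth_total_deriv_pow Q smooth_mult smooth_coord q p) (use k in simp)
  also have "D (total_deriv_pow k Q) p = total_deriv_pow (Suc k) Q p"
    by (subst total_deriv_pow_Suc) (use k in auto)
  also have "D (\<lambda>p. p (k + 2) * ?q p) p = p (k + 3) * ?q p + p (k + 2) * D ?q p"
    using vf_deriv_mult[OF smooth_coord q p, of total_vf "k + 2"] vf_deriv_coord[OF k, of total_vf p]
    by (simp add: total_vf_def numeral_3_eq_3)
  finally show ?thesis
    using vf_deriv_minus[OF q p, of total_vf]
    by (simp add: eta_k_def[of Q "Suc k"] prolonged_vf_0 numeral_3_eq_3 add_2_eq_Suc')
qed

text \<open>The prolongation of a contact vector field preserves the contact structure of the jet
  space: its bracket with the total derivative is a multiple of the total derivative.\<close>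

lemma prolonged_vf_D_commute:
  assumes Q: "smooth_fun_on 3 M Q" and f: "smooth_fun_on m W f" and k: "jet_order k f" "k + 2 < m"
    and p: "p \<in> W"
  shows "vf_deriv m (prolonged_vf Q) (D f) p =
    D (vf_deriv m (prolonged_vf Q) f) p - D (prolonged_vf Q 0) p * D f p"
proof -
  let ?a = "prolonged_vf Q"
  have "vf_deriv m ?a (D f) p - D (vf_deriv m ?a f) p =
      (\<Sum>j<m. (vf_deriv m ?a (total_vf j) p - D (?a j) p) * partial j f p)"
    by (rule vf_deriv_commute[OF smooth_prolonged_vf[OF Q] smooth_total_vf f p])
  also have "\<dots> = (\<Sum>j<m. - D (?a 0) p * (total_vf j p * partial j f p))"
  proof (rule sum.cong)
    fix j assume "j \<in> {..<m}"
    show "(vf_deriv m ?a (total_vf j) p - D (?a j) p) * partial j f p =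
        - D (?a 0) p * (total_vf j p * partial j f p)"
    proof (cases "j \<le> k + 1")
      case False
      then show ?thesis using partial_beyond_jet_order[OF k(1)] by simp
    next
      case True
      show ?thesis
      proof (cases j)
        case 0
        have "total_vf 0 = (\<lambda>_. 1)" by (auto simp: total_vf_def)
        then show ?thesis using 0 by (simp add: vf_deriv_const)
      next
        case (Suc i)
        have i: "i + 2 < m" using True k(2) Suc by simp
        have "total_vf j = (\<lambda>p. p (i + 2))" using Suc by (auto simp: total_vf_def add_2_eq_Suc' One_nat_def)
        moreover have "vf_deriv m ?a (\<lambda>p. p (i + 2)) p = eta_k Q (Suc i) p"
          using vf_deriv_coord[OF i, of ?a p] prolonged_vf_Suc[of Q "Suc i"]
          by (simp add: add_2_eq_Suc')
        ultimately show ?thesis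
          using eta_k_Suc[OF Q i p] Suc by (simp add: prolonged_vf_Suc)
      qed
    qed
  qed simp
  also have "\<dots> = - D (?a 0) p * D f p"
    by (simp add: vf_deriv_def[of m total_vf f] sum_distrib_left sum_negf)
  finally show ?thesis by simp
qed

end

section \<open>Prolonged contact transformations\<close>

text \<open>A contact transformation, prolonged to $J^{m-2}$.\<close>

locale prolonged_contact = base_contact M \<Gamma> for M \<Gamma> +
  fixes m :: nat
  assumes m4: "4 \<le> m"
begin

definition jets :: "point set"
  where "jets = {p \<in> topspace (Euclidean_space m). jet_proj 1 p \<in> M}"

definition regular_jets :: "point set"
  where "regular_jets = {p \<in> jets. D_xhat \<Gamma> p \<noteq> 0}"

abbreviation "\<Phi> \<equiv> prolong \<Gamma> (m - 2)"
abbreviation "D \<equiv> vf_deriv m total_vf"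

lemma jet_domain_jets: "jet_domain m jets M"
proof -
  interpret E: coordinate_domain m "topspace (Euclidean_space m)"
    by unfold_locales auto
  have "continuous_on (topspace (Euclidean_space m)) (jet_proj 1)"
    by (rule continuous_on_coordinatewise_then_product) (rule smooth_fun_on_continuous[OF E.smooth_jet_proj])
  from E.coordinate_domain_preimage[OF open_dom this]
  have "coordinate_domain m jets"
    unfolding jets_def by (simp add: topspace_Euclidean_space jet_proj_def)
  then show ?thesis
    unfolding jet_domain_def jet_domain_axioms_def
    using coordinate_domain_axioms by (auto simp: jets_def)
qed

sublocale J0: jet_domain m jets M by (rule jet_domain_jets)

lemma D_xhat_eq: "D_xhat \<Gamma> = D (\<lambda>q. \<Gamma> (jet_proj 1 q) 0)"
proof -
  have "D_xhat \<Gamma> = total_deriv 1 (\<lambda>q. \<Gamma> (jet_proj 1 q) 0)"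
    using total_deriv_jet_proj[of 1 xh] by simp
  also have "\<dots> = D (\<lambda>q. \<Gamma> (jet_proj 1 q) 0)"
    using m4 by (intro J0.total_deriv_eq_D jet_order_jet_proj[of 1 1 xh]) auto
  finally show ?thesis .
qed

lemma smooth_D_xhat: "smooth_fun_on m jets (D_xhat \<Gamma>)"
  unfolding D_xhat_eq by (intro J0.smooth_D J0.smooth_lift smooth_hat)

lemma jet_domain_regular_jets: "jet_domain m regular_jets M"
  unfolding jet_domain_def jet_domain_axioms_def regular_jets_def
  using J0.coordinate_domain_nonzero[OF smooth_fun_on_continuous[OF smooth_D_xhat]]
    coordinate_domain_axioms by (auto simp: jets_def)

sublocale J: jet_domain m regular_jets M by (rule jet_domain_regular_jets)

lemma regular_jets_subset: "regular_jets \<subseteq> jets"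
  by (auto simp: regular_jets_def)

lemma D_xhat_nonzero: "p \<in> regular_jets \<Longrightarrow> D_xhat \<Gamma> p \<noteq> 0"
  by (simp add: regular_jets_def)

lemma yhat_Suc_Suc: "k + 3 \<le> m \<Longrightarrow> yhat \<Gamma> (Suc (Suc k)) = (\<lambda>p. D (yhat \<Gamma> (Suc k)) p / D_xhat \<Gamma> p)"
  using J0.total_deriv_eq_D[of "Suc k" "yhat \<Gamma> (Suc k)"] jet_order_yhat[of "Suc k" \<Gamma>]
  by (auto simp: fun_eq_iff)

lemma smooth_yhat: "k + 2 \<le> m \<Longrightarrow> smooth_fun_on m regular_jets (yhat \<Gamma> k)"
proof (induction k rule: less_induct)
  case (less k)
  consider "k = 0" | "k = Suc 0" | j where "k = Suc (Suc j)" by (metis not0_implies_Suc)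
  then show ?case
  proof cases
    case 1
    have "yhat \<Gamma> 0 = (\<lambda>p. \<Gamma> (jet_proj 1 p) 1)" by auto
    then show ?thesis using 1 J.smooth_lift[OF smooth_hat(2)] by simp
  next
    case 2
    have "yhat \<Gamma> (Suc 0) = (\<lambda>p. \<Gamma> (jet_proj 1 p) 2)" by auto
    then show ?thesis using 2 J.smooth_lift[OF smooth_hat(3)] by simp
  next
    case 3
    then show ?thesis using less
      by (subst 3, subst yhat_Suc_Suc)
        (auto intro!: smooth_intros J.smooth_divide J.smooth_D D_xhat_nonzero
          smooth_fun_on_subset[OF smooth_D_xhat regular_jets_subset])
  qed
qed

lemma \<Phi>_0: "\<Phi> p 0 = \<Gamma> (jet_proj 1 p) 0"
  and \<Phi>_Suc: "k + 2 \<le> m \<Longrightarrow> \<Phi> p (Suc k) = yhat \<Gamma> k p"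
  by (auto simp: prolong_def)

lemma jet_proj_\<Phi>:
  assumes "jet_proj 1 p \<in> M" shows "jet_proj 1 (\<Phi> p) = \<Gamma> (jet_proj 1 p)"
proof
  fix i :: nat
  consider "i = 0" | "i = 1" | "i = 2" | "i \<ge> 3" by linarith
  then show "jet_proj 1 (\<Phi> p) i = \<Gamma> (jet_proj 1 p) i"
  proof cases
    case 2
    then show ?thesis using \<Phi>_Suc[of 0 p] m4 by (simp add: jet_proj_apply One_nat_def)
  next
    case 3
    then show ?thesis using \<Phi>_Suc[of 1 p] m4 by (simp add: jet_proj_apply One_nat_def numeral_2_eq_2)
  next
    case 4
    then show ?thesis using dom_beyond[OF \<Gamma>_in[OF assms]] by (simp add: jet_proj_def)
  qed (simp add: jet_proj_apply \<Phi>_0)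
qed

lemma \<Phi>_in: "p \<in> regular_jets \<Longrightarrow> \<Phi> p \<in> jets"
  using jet_proj_\<Phi>[of p] \<Gamma>_in[of "jet_proj 1 p"] m4
  by (auto simp: regular_jets_def jets_def topspace_Euclidean_space prolong_def)

lemma smooth_\<Phi>: "i < m \<Longrightarrow> smooth_fun_on m regular_jets (\<lambda>p. \<Phi> p i)"
  using J.smooth_lift[OF smooth_hat(1)] smooth_yhat
  by (cases i) (auto simp: \<Phi>_0 \<Phi>_Suc)

lemma D_lift:
  assumes "f = (\<lambda>p. g (jet_proj 1 p))"
  shows "D f p = partial 0 g (jet_proj 1 p) + p 2 * partial 1 g (jet_proj 1 p) + p 3 * partial 2 g (jet_proj 1 p)"
proof -
  have "D f p = total_deriv 1 g p"
    using J0.total_deriv_eq_D[OF jet_order_jet_proj[of 1 1 g]] m4 assms by (simp add: total_deriv_jet_proj)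
  moreover have "{1..1+1} = {1, 2::nat}" by auto
  ultimately show ?thesis by (simp add: total_deriv_def)
qed

text \<open>The contact condition on all jets: along \<open>D\<close>, the prolonged transformation moves in the
  direction of \<open>D\<close>.\<close>

lemma D_\<Phi>:
  assumes i: "i + 1 < m" and p: "p \<in> regular_jets"
  shows "D (\<lambda>q. \<Phi> q i) p = D_xhat \<Gamma> p * total_vf i (\<Phi> p)"
proof -
  consider "i = 0" | "i = Suc 0" | k where "i = Suc (Suc k)" by (metis not0_implies_Suc)
  then show ?thesis
  proof cases
    case 1
    then show ?thesis by (simp add: total_vf_def \<Phi>_0 D_xhat_eq)
  next
    case 2
    have M: "jet_proj 1 p \<in> M" using p by (rule J.proj_in)
    have "D (\<lambda>q. \<Phi> q i) p = D (\<lambda>p. \<Gamma> (jet_proj 1 p) 1) p"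
      using 2 m4 by (simp add: \<Phi>_Suc)
    also have "\<dots> = D_xhat \<Gamma> p * \<Gamma> (jet_proj 1 p) 2"
      unfolding D_xhat_eq D_lift[of _ xh p, OF refl] D_lift[of _ yh p, OF refl] contact_form_pullback[OF M]
      by (simp add: jet_proj_apply algebra_simps)
    also have "\<Gamma> (jet_proj 1 p) 2 = \<Phi> p (Suc (Suc 0))"
      using m4 by (simp add: \<Phi>_Suc)
    finally show ?thesis using 2 by (simp add: total_vf_Suc numeral_2_eq_2)
  next
    case 3
    have "D (\<lambda>q. \<Phi> q i) p = D (yhat \<Gamma> (Suc k)) p"
      using 3 i by (simp add: \<Phi>_Suc)
    also have "\<dots> = D_xhat \<Gamma> p * yhat \<Gamma> (Suc (Suc k)) p"
      using yhat_Suc_Suc[of k] 3 i D_xhat_nonzero[OF p] by simp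
    finally show ?thesis using 3 i by (simp add: total_vf_Suc add_2_eq_Suc' \<Phi>_Suc)
  qed
qed

text \<open>Only the components of \<open>\<Phi>\<close> up to order \<open>k\<close> enter, and along \<open>D\<close> they change by
  $D\hat x$ times the total derivative field at the image point.\<close>

lemma D_compose_\<Phi>:
  assumes f: "smooth_fun_on m jets f" and k: "jet_order k f" "k + 2 < m" and p: "p \<in> regular_jets"
  shows "D (\<lambda>q. f (\<Phi> q)) p = D_xhat \<Gamma> p * D f (\<Phi> p)"
proof -
  have "D (\<lambda>q. f (\<Phi> q)) p = (\<Sum>i<m. D (\<lambda>q. \<Phi> q i) p * partial i f (\<Phi> p))"
    by (rule J.vf_deriv_compose[OF J0.coordinate_domain_axioms f \<Phi>_in smooth_\<Phi> p])
  also have "\<dots> = (\<Sum>i<m. D_xhat \<Gamma> p * (total_vf i (\<Phi> p) * partial i f (\<Phi> p)))"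
  proof (rule sum.cong)
    fix i assume "i \<in> {..<m}"
    show "D (\<lambda>q. \<Phi> q i) p * partial i f (\<Phi> p) =
        D_xhat \<Gamma> p * (total_vf i (\<Phi> p) * partial i f (\<Phi> p))"
    proof (cases "i \<le> k + 1")
      case True
      then show ?thesis using D_\<Phi>[OF _ p, of i] k(2) by simp
    next
      case False
      then show ?thesis using partial_beyond_jet_order[OF k(1)] by simp
    qed
  qed simp
  finally show ?thesis by (simp add: vf_deriv_def sum_distrib_left)
qed

lemma contact_characteristic_components:
  assumes "contact_characteristic M X Q" "jet_proj 1 p \<in> M" "i < 3"
  shows "prolonged_vf Q i p = X (jet_proj 1 p) i"
proof -
  from assms(3) consider "i = 0" | "i = 1" | "i = 2" by linarith
  then show ?thesis
  proof cases
    case 1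
    then show ?thesis using assms by (simp add: prolonged_vf_0 contact_characteristic_def)
  next
    case 2
    then show ?thesis using assms prolonged_vf_Suc[of Q 0]
      by (simp add: One_nat_def eta_k_0[unfolded One_nat_def] contact_characteristic_def jet_proj_apply)
  next
    case 3
    then show ?thesis using assms prolonged_vf_Suc[of Q 1] eta_k_1[of Q p]
      by (simp add: numeral_2_eq_2 contact_characteristic_def jet_proj_apply)
  qed
qed

text \<open>The prolongation of \<open>\<Gamma>\<^sup>*X\<close> is \<open>\<Phi>\<close>-related to the prolongation of \<open>X\<close>.  On $J^1$ this is the
  definition of the pull-back; from there both sides of the claim satisfy the same recursion.\<close>

lemma prolonged_vf_\<Phi>:
  assumes X: "vector_field_on M X" and Q: "contact_characteristic M X Q"
    and Qh: "contact_characteristic M (pullback_vf M \<Gamma> X) Qh"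
    and p: "p \<in> regular_jets" and i: "i + 1 < m"
  shows "vf_deriv m (prolonged_vf Qh) (\<lambda>q. \<Phi> q i) p = prolonged_vf Q i (\<Phi> p)"
  using p i
proof (induction i arbitrary: p rule: less_induct)
  case (less i)
  let ?v = "vf_deriv m (prolonged_vf Qh)"
  note p = \<open>p \<in> regular_jets\<close> and i = \<open>i + 1 < m\<close>
  have Qs: "smooth_fun_on 3 M Q" and Qhs: "smooth_fun_on 3 M Qh"
    using Q Qh by (auto simp: contact_characteristic_def)
  have base: "?v (\<lambda>q. \<Phi> q j) p = prolonged_vf Q j (\<Phi> p)" if j: "j < 3" and p: "p \<in> regular_jets" for j p
  proof -
    have M: "jet_proj 1 p \<in> M" using p by (rule J.proj_in)
    have \<Phi>M: "jet_proj 1 (\<Phi> p) \<in> M" using jet_proj_\<Phi>[OF M] \<Gamma>_in[OF M] by simp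
    have "?v (\<lambda>q. \<Phi> q j) p = ?v (\<lambda>q. \<Gamma> (jet_proj 1 q) j) p"
    proof (rule J.vf_deriv_cong[OF _ p])
      fix q assume "q \<in> regular_jets"
      then have "jet_proj 1 (\<Phi> q) j = \<Gamma> (jet_proj 1 q) j"
        using jet_proj_\<Phi>[OF J.proj_in] by simp
      then show "\<Phi> q j = \<Gamma> (jet_proj 1 q) j" using j by (simp add: jet_proj_apply)
    qed
    also have "\<dots> = (\<Sum>k<3. ?v (\<lambda>q. jet_proj 1 q k) p * partial k (\<lambda>q. \<Gamma> q j) (jet_proj 1 p))"
      by (rule J.vf_deriv_compose[OF coordinate_domain_axioms smooth_\<Gamma>[OF j] J.proj_in J.smooth_jet_proj p])
    also have "\<dots> = (\<Sum>k<3. prolonged_vf Qh k p * partial k (\<lambda>q. \<Gamma> q j) (jet_proj 1 p))"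
      using m4 by (intro sum.cong) (auto simp: jet_proj_def J.vf_deriv_coord)
    also have "\<dots> = vf_apply (pullback_vf M \<Gamma> X) (\<lambda>q. \<Gamma> q j) (jet_proj 1 p)"
      using contact_characteristic_components[OF Qh M] by (simp add: vf_apply_def)
    also have "\<dots> = X (\<Gamma> (jet_proj 1 p)) j"
      by (rule vf_apply_pullback[OF X M j])
    also have "\<dots> = prolonged_vf Q j (\<Phi> p)"
      using contact_characteristic_components[OF Q \<Phi>M j] jet_proj_\<Phi>[OF M] by simp
    finally show ?thesis .
  qed
  show ?case
  proof (cases "i < 3")
    case True
    then show ?thesis using base p by blast
  next
    case False
    then obtain k where k: "i = Suc (Suc (Suc k))"
      by (metis Suc_diff_Suc add_diff_inverse_nat not_less_eq numeral_3_eq_3 plus_nat.simps(2) add_Suc)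
    let ?y = "yhat \<Gamma> (Suc k)" and ?e = "eta_k Q (Suc k)" and ?x = "\<lambda>q. \<Phi> q 0"
    let ?\<xi> = "D (prolonged_vf Q 0) (\<Phi> p)" and ?\<xi>h = "D (prolonged_vf Qh 0) p"
    have km: "k + 4 < m" using i k by simp
    have y: "smooth_fun_on m regular_jets ?y" using km by (intro smooth_yhat) simp
    have x: "smooth_fun_on m regular_jets ?x" using m4 by (intro smooth_\<Phi>) simp
    have Dx: "D_xhat \<Gamma> = D ?x" by (simp add: D_xhat_eq \<Phi>_0)
    have Dx0: "D ?x p \<noteq> 0" using D_xhat_nonzero[OF p] by (simp add: Dx)
    have vy: "?v ?y q = ?e (\<Phi> q)" if "q \<in> regular_jets" for q
      using less.IH[of "Suc (Suc k)" q] that k km by (simp add: \<Phi>_Suc prolonged_vf_Suc)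
    have Dvy: "D (?v ?y) p = D ?x p * D ?e (\<Phi> p)"
    proof -
      have "D (?v ?y) p = D (\<lambda>q. ?e (\<Phi> q)) p" by (rule J.vf_deriv_cong[OF vy p])
      then show ?thesis
        using D_compose_\<Phi>[OF J0.smooth_eta_k[OF Qs] jet_order_eta_k _ p, of "Suc k"] km
        by (simp add: Dx)
    qed
    have Dvx: "D (?v ?x) p = D ?x p * ?\<xi>"
    proof -
      have "D (?v ?x) p = D (\<lambda>q. prolonged_vf Q 0 (\<Phi> q)) p"
        by (rule J.vf_deriv_cong[OF base p]) simp
      moreover have "jet_order 1 (prolonged_vf Q 0)"
        using jet_order_jet_proj[of 1 1 "\<lambda>p. - partial 2 Q p"] by (simp add: prolonged_vf_0)
      ultimately show ?thesis
        using D_compose_\<Phi>[OF J0.smooth_xi[OF Qs] _ _ p] m4 by (simp add: Dx)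
    qed
    have vDy: "?v (D ?y) p = D ?x p * D ?e (\<Phi> p) - ?\<xi>h * D ?y p"
      using J.prolonged_vf_D_commute[OF Qhs y _ _ p, of "Suc k"] jet_order_yhat[of "Suc k" \<Gamma>] km Dvy
      by simp
    have "jet_order 1 ?x" by (simp add: \<Phi>_0 jet_order_jet_proj[of 1 1 xh])
    then have vDx: "?v (D ?x) p = D ?x p * ?\<xi> - ?\<xi>h * D ?x p"
      using J.prolonged_vf_D_commute[OF Qhs x _ _ p, of 1] m4 Dvx by simp
    have Dy: "D ?y p = D ?x p * \<Phi> p (Suc k + 2)"
      using D_\<Phi>[OF _ p, of "Suc (Suc k)"] km by (simp add: \<Phi>_Suc Dx total_vf_Suc)
    have "?v (\<lambda>q. \<Phi> q i) p = ?v (\<lambda>q. D ?y q / D ?x q) p"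
      using yhat_Suc_Suc[of k] km k by (simp add: \<Phi>_Suc Dx)
    also have "\<dots> = (?v (D ?y) p * D ?x p - D ?y p * ?v (D ?x) p) / (D ?x p * D ?x p)"
      by (rule J.vf_deriv_divide[OF J.smooth_D[OF y] J.smooth_D[OF x] p Dx0])
    also have "\<dots> = D ?e (\<Phi> p) - \<Phi> p (Suc k + 2) * ?\<xi>"
      unfolding vDy vDx Dy using Dx0 by (simp add: divide_simps) (simp add: algebra_simps)
    also have "\<dots> = eta_k Q (Suc (Suc k)) (\<Phi> p)"
      using J0.eta_k_Suc[OF Qs _ \<Phi>_in[OF p], of "Suc k"] km by simp
    finally show ?thesis using k by (simp add: prolonged_vf_Suc)
  qed
qed

end

section \<open>Contact symmetries preserve the linearized symmetry condition\<close>

lemma jet_proj_prolong: "k \<le> l \<Longrightarrow> jet_proj k (prolong \<Gamma> l p) = prolong \<Gamma> k p"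
  by (auto simp: jet_proj_def prolong_def fun_eq_iff)

lemma prolong_jet_proj:
  assumes "k \<le> l" "1 \<le> l" shows "prolong \<Gamma> k (jet_proj l p) = prolong \<Gamma> k p"
proof -
  have "yhat \<Gamma> j (jet_proj l p) = yhat \<Gamma> j p" if "j \<le> l" for j
    by (rule jet_orderD[OF jet_order_mono[OF jet_order_yhat]]) (use that assms in auto)
  then show ?thesis
    using assms by (auto simp: prolong_def fun_eq_iff jet_proj_jet_proj min_absorb1 split: nat.split)
qed

lemma equation_set_jet_proj:
  assumes "n \<ge> 1"
  shows "jet_proj n p \<in> equation_set n \<Omega> \<omega> \<longleftrightarrow>
    jet_proj (n - 1) p \<in> \<Omega> \<and> p (n + 1) = \<omega> (jet_proj (n - 1) p)"
proof -
  have "jet_proj n p \<in> topspace (Euclidean_space (n + 2))"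
    by (simp add: topspace_Euclidean_space jet_proj_def)
  then show ?thesis
    using assms by (simp add: equation_set_def jet_proj_jet_proj jet_proj_apply)
qed

text \<open>The projection of \<open>\<Omega>\<close> is the union, over the points \<open>p\<close> of \<open>\<Omega>\<close>, of the open slices of
  \<open>\<Omega>\<close> obtained by keeping the coordinates of \<open>p\<close> from $y''$ on.\<close>

lemma base_domain_open:
  assumes "n \<ge> 2" "openin (Euclidean_space (n + 1)) \<Omega>"
  shows "openin (Euclidean_space 3) (base_domain \<Omega>)"
proof -
  interpret E: coordinate_domain 3 "topspace (Euclidean_space 3)" by unfold_locales auto
  interpret O: coordinate_domain "n + 1" \<Omega> by unfold_locales fact
  define g where "g p q = (\<lambda>i. if i < 3 then q i else p i)" for p q :: point
  define V where "V p = {q \<in> topspace (Euclidean_space 3). g p q \<in> \<Omega>}" for p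
  have "coordinate_domain 3 (V p)" if "p \<in> \<Omega>" for p
    unfolding V_def
  proof (rule E.coordinate_domain_preimage[OF assms(2)])
    have "continuous_on (topspace (Euclidean_space 3)) (\<lambda>q. g p q i)" for i
      using smooth_fun_on_continuous[OF E.smooth_coord] by (cases "i < 3") (auto simp: g_def)
    then show "continuous_on (topspace (Euclidean_space 3)) (g p)"
      by (rule continuous_on_coordinatewise_then_product)
    show "g p q \<in> topspace (Euclidean_space (n + 1))" for q
      using O.dom_beyond[OF that] assms(1) by (auto simp: g_def topspace_Euclidean_space)
  qed
  then have "openin (Euclidean_space 3) (\<Union>p\<in>\<Omega>. V p)"
    by (intro openin_Union) (auto simp: coordinate_domain_def)
  moreover have "(\<Union>p\<in>\<Omega>. V p) = base_domain \<Omega>"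
  proof (intro equalityI subsetI)
    fix q assume "q \<in> (\<Union>p\<in>\<Omega>. V p)"
    then obtain p where "q \<in> topspace (Euclidean_space 3)" "g p q \<in> \<Omega>" by (auto simp: V_def)
    moreover from this have "jet_proj 1 (g p q) = q"
      by (auto simp: g_def jet_proj_def topspace_Euclidean_space fun_eq_iff)
    ultimately show "q \<in> base_domain \<Omega>" unfolding base_domain_def by (metis imageI)
  next
    fix q assume "q \<in> base_domain \<Omega>"
    then obtain p where p: "p \<in> \<Omega>" "q = jet_proj 1 p" by (auto simp: base_domain_def)
    then have "g p q = p" by (auto simp: g_def jet_proj_def fun_eq_iff)
    then have "q \<in> V p"
      using p by (simp add: V_def topspace_Euclidean_space jet_proj_def)
    with p show "q \<in> (\<Union>p\<in>\<Omega>. V p)" by blast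
  qed
  ultimately show ?thesis by simp
qed

text \<open>The right-hand side of the linearized symmetry condition is the derivative of \<open>\<omega>\<close> along the
  prolonged field.\<close>

lemma vf_deriv_prolonged_rhs:
  assumes n: "n \<ge> 2"
  shows "vf_deriv (n + 3) (prolonged_vf Q) (\<lambda>q. \<omega> (jet_proj (n - 1) q)) p =
    prolonged_vf Q 0 p * partial 0 \<omega> (jet_proj (n - 1) p) +
    (\<Sum>k<n. eta_k Q k p * partial (k + 1) \<omega> (jet_proj (n - 1) p))"
proof -
  let ?f = "\<lambda>q. \<omega> (jet_proj (n - 1) q)"
  have "vf_deriv (n + 3) (prolonged_vf Q) ?f p = (\<Sum>i<Suc n. prolonged_vf Q i p * partial i ?f p)"
    unfolding vf_deriv_def
    using partial_beyond_jet_order[OF jet_order_jet_proj[of "n - 1" "n - 1" \<omega>]] n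
    by (intro sum.mono_neutral_right) auto
  also have "\<dots> = (\<Sum>i<Suc n. prolonged_vf Q i p * partial i \<omega> (jet_proj (n - 1) p))"
    using n by (intro sum.cong) (auto simp: partial_jet_proj)
  finally show ?thesis
    by (simp add: sum.lessThan_Suc_shift prolonged_vf_Suc One_nat_def del: sum.lessThan_Suc)
qed

context prolonged_contact begin

text \<open>$\hat y^{(k)}$ depends on $y^{(k)}$ through a nonvanishing derivative, for $k\ge2$.  For $k=2$ the numerator of
  the quotient rule is the determinant of $(d\hat x, d\hat y')$ on the contact plane; every further order
  divides the derivative by $D\hat x$.\<close>

lemma partial_yhat_top_nonzero:
  assumes p: "p \<in> regular_jets"
  shows "partial (k + 3) (yhat \<Gamma> (Suc (Suc k))) p \<noteq> 0"
proof (induction k)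
  case 0
  let ?q = "jet_proj 1 p"
  have M: "?q \<in> M" using p by (rule J.proj_in)
  have zl: "yhat \<Gamma> (Suc 0) = (\<lambda>p. zh (jet_proj 1 p))" by auto
  have N: "total_deriv 1 (yhat \<Gamma> (Suc 0)) = total_deriv 1 zh"
    unfolding zl by (rule total_deriv_jet_proj)
  have lin: "total_deriv 1 f r = partial 0 f (jet_proj 1 r) + r 2 * partial 1 f (jet_proj 1 r)
      + r 3 * partial 2 f (jet_proj 1 r)" for f r
  proof -
    have "{1..1+1} = {1, 2::nat}" by auto
    then show ?thesis by (simp add: total_deriv_def)
  qed
  have der: "((\<lambda>t. total_deriv 1 f (p(3 := t))) has_real_derivative partial 2 f ?q) (at (p 3))" for f
    unfolding lin using jet_proj_upd_beyond[of 1 3 p] by (auto intro!: derivative_eq_intros)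
  have nz: "D_xhat \<Gamma> p \<noteq> 0" by (rule D_xhat_nonzero[OF p])
  have "partial 3 (yhat \<Gamma> (Suc (Suc 0))) p =
      (partial 2 zh ?q * D_xhat \<Gamma> p - total_deriv 1 zh p * partial 2 xh ?q) / (D_xhat \<Gamma> p * D_xhat \<Gamma> p)"
  proof -
    have "yhat \<Gamma> (Suc (Suc 0)) = (\<lambda>p. total_deriv 1 zh p / D_xhat \<Gamma> p)"
      using N by (auto simp: One_nat_def)
    then show ?thesis
      unfolding partial_def[of 3] using DERIV_imp_deriv[OF DERIV_divide[OF der der]] nz by simp
  qed
  moreover have "partial 2 zh ?q * D_xhat \<Gamma> p - total_deriv 1 zh p * partial 2 xh ?q \<noteq> 0"
  proof -
    let ?ex = "partial 0 xh ?q + ?q 2 * partial 1 xh ?q"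
    let ?ez = "partial 0 zh ?q + ?q 2 * partial 1 zh ?q"
    have q2: "?q 2 = p 2" by (simp add: jet_proj_apply)
    have "partial 2 xh ?q \<noteq> 0 \<or> - ?ex \<noteq> 0" using nz unfolding lin q2 by auto
    then have "partial 2 xh ?q * ?ez + (- ?ex) * partial 2 zh ?q \<noteq> 0"
      by (rule contact_plane_nondegenerate[OF M]) (simp add: algebra_simps)
    then show ?thesis unfolding lin q2 by (simp add: algebra_simps)
  qed
  ultimately have "partial 3 (yhat \<Gamma> (Suc (Suc 0))) p \<noteq> 0" using nz by (simp del: yhat.simps)
  then show ?case by (simp del: yhat.simps)
next
  case (Suc k)
  let ?f = "yhat \<Gamma> (Suc (Suc k))"
  have Df: "D_xhat \<Gamma> (p(k + 4 := t)) = D_xhat \<Gamma> p" for t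
    using jet_orderD[OF jet_order_D_xhat, of \<Gamma> "p(k + 4 := t)"] jet_orderD[OF jet_order_D_xhat, of \<Gamma> p]
    by (simp add: jet_proj_upd_beyond)
  have k: "Suc (Suc k) + 2 = k + 4" "Suc (Suc k) + 1 = k + 3" by simp_all
  have "((\<lambda>t. total_deriv (Suc (Suc k)) ?f (p(k + 4 := t)) / D_xhat \<Gamma> p) has_real_derivative
      partial (k + 3) ?f (jet_proj (Suc (Suc k)) p) / D_xhat \<Gamma> p) (at (p (k + 4)))"
    unfolding total_deriv_upd_top[of "Suc (Suc k)" ?f p, unfolded k]
    using D_xhat_nonzero[OF p] by (auto intro!: derivative_eq_intros simp del: yhat.simps)
  then have "partial (k + 4) (yhat \<Gamma> (Suc (Suc (Suc k)))) p =
      partial (k + 3) ?f (jet_proj (Suc (Suc k)) p) / D_xhat \<Gamma> p"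
    unfolding partial_def[of "k + 4"] yhat.simps(3) Df by (rule DERIV_imp_deriv)
  also have "partial (k + 3) ?f (jet_proj (Suc (Suc k)) p) = partial (k + 3) ?f p"
    using jet_orderD[OF jet_order_partial] jet_order_yhat[of "Suc (Suc k)" \<Gamma>]
    by (simp del: yhat.simps)
  finally show ?case using Suc D_xhat_nonzero[OF p] by (simp del: yhat.simps add: add.commute)
qed

end

text \<open>Everything takes place in $J^{n+1}$, where $\eta^{(n)}$ and $y^{(n+1)}$ are defined; it has
  dimension $n+3$.\<close>

locale equation_symmetry =
  fixes n :: nat and \<Omega> :: "point set" and \<omega> :: "point \<Rightarrow> real" and \<Gamma> :: "point \<Rightarrow> point"
  assumes n: "n \<ge> 3"
    and Omega: "openin (Euclidean_space (n + 1)) \<Omega>"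
    and omega: "smooth_fun_on (n + 1) \<Omega> \<omega>"
    and symmetry: "contact_symmetry n \<Omega> \<omega> \<Gamma>"

sublocale equation_symmetry \<subseteq> prolonged_contact "base_domain \<Omega>" \<Gamma> "n + 3"
proof unfold_locales
  show "openin (Euclidean_space 3) (base_domain \<Omega>)"
    using n Omega by (intro base_domain_open) auto
  show "contact_transformation (base_domain \<Omega>) \<Gamma>"
    using symmetry by (simp add: contact_symmetry_def)
qed (use n in simp)

context equation_symmetry begin

abbreviation "m \<equiv> n + 3"

lemma \<Omega>_domain: "coordinate_domain (n + 1) \<Omega>"
  by unfold_locales (rule Omega)

text \<open>The right-hand side of the equation makes sense on the jets over \<open>\<Omega>\<close>.\<close>

definition jets_over :: "point set"
  where "jets_over = {p \<in> topspace (Euclidean_space m). jet_proj (n - 1) p \<in> \<Omega>}"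

lemma jets_over_subset: "jets_over \<subseteq> jets"
proof
  fix p assume "p \<in> jets_over"
  then have p: "p \<in> topspace (Euclidean_space m)" "jet_proj (n - 1) p \<in> \<Omega>"
    by (auto simp: jets_over_def)
  have "jet_proj 1 (jet_proj (n - 1) p) = jet_proj 1 p" using n by (simp add: jet_proj_jet_proj)
  then have "jet_proj 1 p \<in> base_domain \<Omega>" using p(2) unfolding base_domain_def by (metis imageI)
  then show "p \<in> jets" using p(1) by (simp add: jets_def)
qed

lemma jets_over_domain: "coordinate_domain m jets_over"
proof -
  interpret E: coordinate_domain m "topspace (Euclidean_space m)" by unfold_locales auto
  have "continuous_on (topspace (Euclidean_space m)) (jet_proj (n - 1))"
    by (rule continuous_on_coordinatewise_then_product) (rule smooth_fun_on_continuous[OF E.smooth_jet_proj])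
  from E.coordinate_domain_preimage[OF Omega this] show ?thesis
    unfolding jets_over_def using n by (simp add: topspace_Euclidean_space jet_proj_def)
qed

sublocale JO: coordinate_domain m jets_over by (rule jets_over_domain)

abbreviation "rhs \<equiv> \<lambda>p. \<omega> (jet_proj (n - 1) p)"

lemma smooth_rhs: "smooth_fun_on m jets_over rhs"
  by (rule JO.smooth_compose[OF \<Omega>_domain omega _ JO.smooth_jet_proj]) (simp add: jets_over_def)

text \<open>An open set of jets on which the transformed equation makes sense, also off the equation; this is what
  allows it to be differentiated.\<close>

definition transformed_jets :: "point set"
  where "transformed_jets = {p \<in> regular_jets. jet_proj (n - 1) (\<Phi> p) \<in> \<Omega>}"

lemma smooth_proj_\<Phi>: "smooth_fun_on m regular_jets (\<lambda>p. jet_proj (n - 1) (\<Phi> p) i)"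
proof -
  have "n - 1 + 1 = n" using n by simp
  then show ?thesis
    using smooth_\<Phi>[of i] by (cases "i \<le> n") (auto simp: jet_proj_def intro: J.smooth_const)
qed

lemma transformed_jets_domain: "coordinate_domain m transformed_jets"
  unfolding transformed_jets_def
proof (rule J.coordinate_domain_preimage[OF Omega])
  show "continuous_on regular_jets (\<lambda>p. jet_proj (n - 1) (\<Phi> p))"
    by (rule continuous_on_coordinatewise_then_product) (rule smooth_fun_on_continuous[OF smooth_proj_\<Phi>])
  show "jet_proj (n - 1) (\<Phi> p) \<in> topspace (Euclidean_space (n + 1))" for p
    using n by (auto simp: topspace_Euclidean_space jet_proj_def)
qed

sublocale T: coordinate_domain m transformed_jets by (rule transformed_jets_domain)

lemma transformed_subset: "transformed_jets \<subseteq> regular_jets"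
  by (auto simp: transformed_jets_def)

abbreviation "E \<equiv> equation_set n \<Omega> \<omega>"

lemma D_xhat_jet_proj: "D_xhat \<Gamma> (jet_proj n p) = D_xhat \<Gamma> p"
  by (rule jet_orderD[OF jet_order_mono[OF jet_order_D_xhat]]) (use n in simp)

lemma symmetry_on_regular_jets:
  assumes p: "p \<in> regular_jets" "jet_proj n p \<in> E"
  shows "p \<in> transformed_jets" and "yhat \<Gamma> n p = rhs (\<Phi> p)"
    and "jet_proj n (\<Phi> p) \<in> E"
proof -
  have "D_xhat \<Gamma> (jet_proj n p) \<noteq> 0" using D_xhat_nonzero[OF p(1)] by (simp add: D_xhat_jet_proj)
  then have "prolong \<Gamma> (n - 1) (jet_proj n p) \<in> \<Omega>"
    "yhat \<Gamma> n (jet_proj n p) = \<omega> (prolong \<Gamma> (n - 1) (jet_proj n p))"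
    using symmetry p(2) unfolding contact_symmetry_def Let_def by blast+
  moreover have "prolong \<Gamma> (n - 1) (jet_proj n p) = jet_proj (n - 1) (\<Phi> p)"
    using n by (simp add: prolong_jet_proj jet_proj_prolong)
  moreover have "yhat \<Gamma> n (jet_proj n p) = yhat \<Gamma> n p"
    by (rule jet_orderD[OF jet_order_mono[OF jet_order_yhat]]) (use n in auto)
  ultimately show "p \<in> transformed_jets" and *: "yhat \<Gamma> n p = rhs (\<Phi> p)"
    and "jet_proj n (\<Phi> p) \<in> E"
    using p(1) n \<Phi>_Suc[of n p]
    by (auto simp: transformed_jets_def equation_set_jet_proj One_nat_def)
qed

lemma linearized_symmetry_conditionD:
  assumes Q: "contact_characteristic (base_domain \<Omega>) X Q"
    and lin: "linearized_symmetry_condition n \<Omega> \<omega> X Q"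
    and p: "p \<in> topspace (Euclidean_space m)" "jet_proj n p \<in> E"
  shows "eta_k Q n p = vf_deriv m (prolonged_vf Q) rhs p"
proof -
  have "p \<in> jets_over" using p n by (simp add: jets_over_def equation_set_jet_proj)
  then have "jet_proj 1 p \<in> base_domain \<Omega>" using jets_over_subset J0.proj_in by blast
  then have "prolonged_vf Q 0 p = X (jet_proj 1 p) 0"
    using contact_characteristic_components[OF Q] by simp
  then show ?thesis
    using lin p n vf_deriv_prolonged_rhs[of n Q \<omega> p] unfolding linearized_symmetry_condition_def by auto
qed

text \<open>Tangency at regular jets.  \<open>G\<close> moves a jet along $y^{(n)}$ into the equation, where \<open>F\<close>
  vanishes, so $F\circ G = 0$.  Differentiating this along the prolongation of $\hat X$ and using that \<open>F\<close> is
  annihilated by it leaves only the product of $\partial F/\partial y^{(n)}$ with the defect in the linearized symmetry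
  condition.\<close>

lemma pullback_linearized_regular:
  assumes X: "vector_field_on (base_domain \<Omega>) X"
    and Q: "contact_characteristic (base_domain \<Omega>) X Q"
    and lin: "linearized_symmetry_condition n \<Omega> \<omega> X Q"
    and Qh: "contact_characteristic (base_domain \<Omega>) (pullback_vf (base_domain \<Omega>) \<Gamma> X) Qh"
    and p: "p \<in> regular_jets" "jet_proj n p \<in> E"
  shows "eta_k Qh n p = vf_deriv m (prolonged_vf Qh) rhs p"
proof -
  let ?v = "vf_deriv m (prolonged_vf Qh)"
  define F where "F = (\<lambda>q. yhat \<Gamma> n q - rhs (\<Phi> q))"
  define G where "G q = q(n + 1 := rhs q)" for q :: point
  have pT: "p \<in> transformed_jets" by (rule symmetry_on_regular_jets(1)[OF p])
  have pr: "jet_proj (n - 1) p \<in> \<Omega>" "rhs p = p (n + 1)"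
    using p(2) n by (auto simp: equation_set_jet_proj)
  have pO: "p \<in> jets_over"
    using p(1) pr regular_jets_subset by (auto simp: jets_over_def jets_def)
  have rhs\<Phi>: "smooth_fun_on m transformed_jets (\<lambda>q. rhs (\<Phi> q))"
    by (rule T.smooth_compose[OF \<Omega>_domain omega _
          smooth_fun_on_subset[OF smooth_proj_\<Phi> transformed_subset]])
      (simp add: transformed_jets_def)
  have yn: "smooth_fun_on m transformed_jets (yhat \<Gamma> n)"
    by (intro smooth_fun_on_subset[OF smooth_yhat transformed_subset]) simp
  have Fs: "smooth_fun_on m transformed_jets F"
    unfolding F_def by (intro T.smooth_diff yn rhs\<Phi>)
  \<comment> \<open>\<open>F\<close> is annihilated: this is the linearized symmetry condition for \<open>X\<close> at the image point\<close>
  have vF: "?v F p = 0"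
  proof -
    have v\<Phi>: "?v (\<lambda>q. \<Phi> q i) p = prolonged_vf Q i (\<Phi> p)" if "i < n + 2" for i
      using prolonged_vf_\<Phi>[OF X Q Qh p(1), of i] that by simp
    have "?v (yhat \<Gamma> n) p = eta_k Q n (\<Phi> p)"
    proof -
      have "(\<lambda>q. \<Phi> q (Suc n)) = yhat \<Gamma> n" using \<Phi>_Suc[of n] by auto
      then show ?thesis using v\<Phi>[of "Suc n"] by (simp only: prolonged_vf_Suc)
    qed
    moreover have "?v (\<lambda>q. rhs (\<Phi> q)) p = vf_deriv m (prolonged_vf Q) rhs (\<Phi> p)"
    proof -
      have "?v (\<lambda>q. rhs (\<Phi> q)) p =
          (\<Sum>i<n+1. ?v (\<lambda>q. jet_proj (n - 1) (\<Phi> q) i) p * partial i \<omega> (jet_proj (n - 1) (\<Phi> p)))"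
        by (rule T.vf_deriv_compose[OF \<Omega>_domain omega _
              smooth_fun_on_subset[OF smooth_proj_\<Phi> transformed_subset] pT])
          (simp add: transformed_jets_def)
      also have "\<dots> = (\<Sum>i<Suc n. prolonged_vf Q i (\<Phi> p) * partial i \<omega> (jet_proj (n - 1) (\<Phi> p)))"
        using n v\<Phi> by (intro sum.cong) (auto simp: jet_proj_def)
      also have "\<dots> = vf_deriv m (prolonged_vf Q) rhs (\<Phi> p)"
        using n vf_deriv_prolonged_rhs[of n Q \<omega> "\<Phi> p"]
        by (simp add: sum.lessThan_Suc_shift prolonged_vf_Suc One_nat_def del: sum.lessThan_Suc)
      finally show ?thesis .
    qed
    moreover have "eta_k Q n (\<Phi> p) = vf_deriv m (prolonged_vf Q) rhs (\<Phi> p)"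
      using \<Phi>_in[OF p(1)] symmetry_on_regular_jets(3)[OF p]
      by (intro linearized_symmetry_conditionD[OF Q lin]) (auto simp: jets_def)
    ultimately show ?thesis
      unfolding F_def using T.vf_deriv_diff[OF yn rhs\<Phi> pT] by simp
  qed
  have Gs: "smooth_fun_on m jets_over (\<lambda>q. G q i)" for i
    unfolding G_def by (cases "i = n + 1") (auto intro: smooth_rhs JO.smooth_coord)
  define V where "V = {q \<in> jets_over. G q \<in> transformed_jets}"
  have Vdom: "coordinate_domain m V"
    unfolding V_def
  proof (rule JO.coordinate_domain_preimage[OF transformed_jets_domain[unfolded coordinate_domain_def]])
    show "continuous_on jets_over G"
      by (rule continuous_on_coordinatewise_then_product) (rule smooth_fun_on_continuous[OF Gs])
    show "G q \<in> topspace (Euclidean_space m)" if "q \<in> jets_over" for q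
      using that by (auto simp: jets_over_def G_def topspace_Euclidean_space)
  qed
  interpret V: coordinate_domain m V by (rule Vdom)
  have Gp: "G p = p" using pr by (simp add: G_def)
  then have pV: "p \<in> V" using pO pT by (simp add: V_def)
  have FG: "F (G q) = 0" if "q \<in> V" for q
  proof -
    have q: "jet_proj (n - 1) q \<in> \<Omega>" "G q \<in> transformed_jets"
      using that by (auto simp: V_def jets_over_def)
    have "jet_proj (n - 1) (G q) = jet_proj (n - 1) q"
      using n by (simp add: G_def jet_proj_upd_beyond)
    then have "jet_proj n (G q) \<in> E"
      using q(1) n by (simp add: equation_set_jet_proj) (simp add: G_def)
    then show ?thesis
      using symmetry_on_regular_jets(2)[of "G q"] q(2) transformed_subset by (auto simp: F_def)
  qed
  have "0 = ?v (\<lambda>q. F (G q)) p"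
    using V.vf_deriv_cong[OF FG pV] by (simp add: V.vf_deriv_const)
  also have "\<dots> = (\<Sum>i<m. ?v (\<lambda>q. G q i) p * partial i F (G p))"
    by (rule V.vf_deriv_compose[OF transformed_jets_domain Fs _ smooth_fun_on_subset[OF Gs] pV])
      (auto simp: V_def)
  also have "\<dots> = (\<Sum>i<m. prolonged_vf Qh i p * partial i F p +
      (if i = n + 1 then (?v rhs p - eta_k Qh n p) * partial i F p else 0))"
  proof (rule sum.cong)
    fix i assume "i \<in> {..<m}"
    then have "?v (\<lambda>q. G q i) p = (if i = n + 1 then ?v rhs p else prolonged_vf Qh i p)"
      by (auto simp: G_def V.vf_deriv_coord)
    moreover have "prolonged_vf Qh (n + 1) = eta_k Qh n"
      using prolonged_vf_Suc[of Qh n] by (simp add: One_nat_def)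
    ultimately show "?v (\<lambda>q. G q i) p * partial i F (G p) = prolonged_vf Qh i p * partial i F p +
      (if i = n + 1 then (?v rhs p - eta_k Qh n p) * partial i F p else 0)"
      unfolding Gp by (auto simp: algebra_simps)
  qed simp
  also have "\<dots> = ?v F p + (?v rhs p - eta_k Qh n p) * partial (n + 1) F p"
    by (simp add: sum.distrib vf_deriv_def[of m _ F])
  finally have "(?v rhs p - eta_k Qh n p) * partial (n + 1) F p = 0" using vF by simp
  moreover have "partial (n + 1) F p \<noteq> 0"
  proof -
    obtain k where k: "n = Suc (Suc k)" by (rule that[of "n - 2"]) (use n in arith)
    have "jet_order (n - 1) (\<lambda>q. rhs (\<Phi> q))"
    proof -
      have "jet_proj (n - 1) (\<Phi> (jet_proj (n - 1) q)) = jet_proj (n - 1) (\<Phi> q)" for q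
        using n by (simp add: jet_proj_prolong prolong_jet_proj)
      then show ?thesis by (simp add: jet_order_def)
    qed
    then have "partial (n + 1) (\<lambda>q. rhs (\<Phi> q)) p = 0"
      using n by (intro partial_beyond_jet_order) auto
    moreover have "partial (n + 1) F p = partial (n + 1) (yhat \<Gamma> n) p - partial (n + 1) (\<lambda>q. rhs (\<Phi> q)) p"
      unfolding F_def by (rule T.partial_diff[OF yn rhs\<Phi> pT]) simp
    moreover have "partial (n + 1) (yhat \<Gamma> n) p \<noteq> 0"
    proof -
      have "n + 1 = k + 3" using k by arith
      then show ?thesis
        using partial_yhat_top_nonzero[OF p(1), of k] unfolding k[symmetric] by (simp only: not_False_eq_True)
    qed
    ultimately show ?thesis by simp
  qed
  ultimately show ?thesis by simp
qed

end

context equation_symmetry begin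

lemma pullback_linearized:
  assumes X: "vector_field_on (base_domain \<Omega>) X"
    and Q: "contact_characteristic (base_domain \<Omega>) X Q"
    and lin: "linearized_symmetry_condition n \<Omega> \<omega> X Q"
    and Qh: "contact_characteristic (base_domain \<Omega>) (pullback_vf (base_domain \<Omega>) \<Gamma> X) Qh"
  shows "linearized_symmetry_condition n \<Omega> \<omega> (pullback_vf (base_domain \<Omega>) \<Gamma> X) Qh"
  unfolding linearized_symmetry_condition_def
proof (intro ballI impI)
  fix p assume p: "p \<in> topspace (Euclidean_space (n + 3))" "jet_proj n p \<in> E"
  define h where "h q = eta_k Qh n q - vf_deriv m (prolonged_vf Qh) rhs q" for q
  define r where "r q = q(n + 2 := p (n + 2))" for q :: point
  define S where "S = {q \<in> E. D_xhat \<Gamma> q \<noteq> 0}"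
  have Qhs: "smooth_fun_on 3 (base_domain \<Omega>) Qh"
    using Qh by (simp add: contact_characteristic_def)
  have rO: "r q \<in> jets_over" and rE: "jet_proj n (r q) = q" if "q \<in> E" for q
  proof -
    have q: "q \<in> topspace (Euclidean_space (n + 2))" "jet_proj (n - 1) q \<in> \<Omega>"
      using that by (auto simp: equation_set_def)
    have "jet_proj (n - 1) (r q) = jet_proj (n - 1) q"
      using n by (simp add: r_def jet_proj_upd_beyond)
    then show "r q \<in> jets_over"
      using q by (auto simp: jets_over_def r_def topspace_Euclidean_space)
    have "jet_proj n (r q) = jet_proj n q" by (simp add: r_def jet_proj_upd_beyond)
    then show "jet_proj n (r q) = q" using jet_proj_Euclidean_space[OF _ q(1), of n] by simp
  qed
  have "smooth_fun_on m jets_over h"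
    unfolding h_def
    by (intro JO.smooth_diff JO.smooth_vf_deriv smooth_rhs
        smooth_fun_on_subset[OF J0.smooth_eta_k jets_over_subset]
        smooth_fun_on_subset[OF J0.smooth_prolonged_vf jets_over_subset] Qhs) auto
  moreover have "continuous_on E r"
  proof (rule continuous_on_coordinatewise_then_product)
    fix i
    have "continuous_on E (\<lambda>q. q i)"
      by (rule continuous_on_subset[OF continuous_on_product_coordinates]) simp
    then show "continuous_on E (\<lambda>q. r q i)" by (cases "i = n + 2") (auto simp: r_def)
  qed
  ultimately have cont: "continuous_on E (\<lambda>q. h (r q))"
    using rO by (intro continuous_on_compose2[OF smooth_fun_on_continuous]) auto
  have "h (r q) = 0" if "q \<in> S" for q
  proof -
    have q: "q \<in> E" "D_xhat \<Gamma> q \<noteq> 0" using that by (auto simp: S_def)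
    then have "D_xhat \<Gamma> (r q) \<noteq> 0" using D_xhat_jet_proj[of "r q"] rE[OF q(1)] by simp
    then have "r q \<in> regular_jets" using rO[OF q(1)] jets_over_subset by (auto simp: regular_jets_def)
    then show ?thesis
      using pullback_linearized_regular[OF X Q lin Qh] rE[OF q(1)] q(1) by (simp add: h_def)
  qed
  \<comment> \<open>the regular points are dense in the equation, and both sides are continuous\<close>
  moreover obtain T where T: "closed T" "{q \<in> E. h (r q) = 0} = E \<inter> T"
    using continuous_closedin_preimage_constant[OF cont, of 0] by (auto simp: closedin_closed)
  ultimately have "S \<subseteq> T" by (auto simp: S_def)
  then have "closure S \<subseteq> T" using T(1) by (rule closure_minimal)
  moreover have "E \<subseteq> closure S"
    using symmetry by (simp add: contact_symmetry_def Let_def S_def)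
  ultimately have "h (r (jet_proj n p)) = 0" using T(2) p(2) by blast
  moreover have "r (jet_proj n p) = p"
    using p(1) by (auto simp: r_def jet_proj_def topspace_Euclidean_space fun_eq_iff)
  ultimately have "eta_k Qh n p = vf_deriv m (prolonged_vf Qh) rhs p"
    by (simp add: h_def)
  moreover have "jet_proj 1 p \<in> base_domain \<Omega>"
  proof -
    have "p \<in> jets_over" using p n by (simp add: jets_over_def equation_set_jet_proj)
    then show ?thesis using jets_over_subset J0.proj_in by blast
  qed
  ultimately show "eta_k Qh n p = pullback_vf (base_domain \<Omega>) \<Gamma> X (jet_proj 1 p) 0 * partial 0 \<omega> (jet_proj (n - 1) p) +
         (\<Sum>k<n. eta_k Qh k p * partial (k + 1) \<omega> (jet_proj (n - 1) p))"
    using contact_characteristic_components[OF Qh, of p 0] n by (simp add: vf_deriv_prolonged_rhs)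
qed

lemma contact_generators_iff:
  "X \<in> contact_generators n \<Omega> \<omega> \<longleftrightarrow> vector_field_on (base_domain \<Omega>) X \<and>
    (\<exists>Q. contact_characteristic (base_domain \<Omega>) X Q \<and> linearized_symmetry_condition n \<Omega> \<omega> X Q)"
  by (auto simp: contact_generators_def contact_characteristic_def)

lemma pullback_contact_generators:
  assumes "X \<in> contact_generators n \<Omega> \<omega>"
  shows "pullback_vf (base_domain \<Omega>) \<Gamma> X \<in> contact_generators n \<Omega> \<omega>"
proof -
  obtain Q where X: "vector_field_on (base_domain \<Omega>) X"
    and Q: "contact_characteristic (base_domain \<Omega>) X Q" "linearized_symmetry_condition n \<Omega> \<omega> X Q"
    using assms by (auto simp: contact_generators_iff)
  note Qh = contact_characteristic_pullback[OF X Q(1)]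
  show ?thesis
    using vector_field_on_pullback[OF X] Qh pullback_linearized[OF X Q Qh]
    unfolding contact_generators_iff by blast
qed

end

section \<open>Change of basis\<close>

lemma span_range_family:
  fixes Y :: "'n::finite \<Rightarrow> 'a::real_vector"
  assumes "x \<in> span (range Y)"
  shows "\<exists>u. x = (\<Sum>l\<in>UNIV. u l *\<^sub>R Y l)"
proof -
  let ?V = "range (\<lambda>u. \<Sum>l\<in>UNIV. u l *\<^sub>R Y l)"
  have "subspace ?V"
  proof (rule subspaceI)
    show "0 \<in> ?V" by (rule range_eqI[of _ _ "\<lambda>_. 0"]) simp
  next
    fix x y assume "x \<in> ?V" "y \<in> ?V"
    then obtain u w where uw: "x = (\<Sum>l\<in>UNIV. u l *\<^sub>R Y l)" "y = (\<Sum>l\<in>UNIV. w l *\<^sub>R Y l)" by blast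
    show "x + y \<in> ?V"
      by (rule range_eqI[of _ _ "\<lambda>l. u l + w l"]) (simp add: uw scaleR_add_left sum.distrib)
  next
    fix c x assume "x \<in> ?V"
    then obtain u where u: "x = (\<Sum>l\<in>UNIV. u l *\<^sub>R Y l)" by blast
    show "c *\<^sub>R x \<in> ?V"
      by (rule range_eqI[of _ _ "\<lambda>l. c * u l"]) (simp add: u scaleR_sum_right)
  qed
  moreover have "range Y \<subseteq> ?V"
  proof safe
    fix j
    show "Y j \<in> ?V"
      by (rule range_eqI[of _ _ "\<lambda>l. if l = j then 1 else 0"]) (simp add: if_distrib[of "\<lambda>c. c *\<^sub>R _"] cong: if_cong)
  qed
  ultimately have "span (range Y) \<subseteq> ?V" by (intro span_minimal)
  then show ?thesis using assms by blast
qed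

lemma independent_family_coefficients:
  fixes X :: "'n::finite \<Rightarrow> 'a::real_vector"
  assumes "inj X" "independent (range X)" "(\<Sum>k\<in>UNIV. u k *\<^sub>R X k) = (\<Sum>k\<in>UNIV. w k *\<^sub>R X k)"
  shows "u k = w k"
proof -
  let ?d = "\<lambda>v. u (inv X v) - w (inv X v)"
  have "(\<Sum>v\<in>range X. ?d v *\<^sub>R v) = (\<Sum>k\<in>UNIV. (u k - w k) *\<^sub>R X k)"
    using assms(1) by (subst sum.reindex) auto
  also have "\<dots> = 0" using assms(3) by (simp add: scaleR_diff_left sum_subtractf)
  finally have "?d (X k) = 0" using assms(2) by (intro independentD[of "range X" "range X"]) auto
  then show ?thesis using assms(1) by simp
qed

lemma change_of_basis_invertible:
  fixes X Y :: "'n::finite \<Rightarrow> 'a::real_vector"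
  assumes X: "inj X" "independent (range X)"
    and "range X \<subseteq> span (range Y)" "range Y \<subseteq> span (range X)"
  shows "\<exists>b :: real^'n^'n. invertible b \<and> (\<forall>i. X i = (\<Sum>l\<in>UNIV. (b $ i $ l) *\<^sub>R Y l))"
proof -
  have "\<forall>i. \<exists>u. X i = (\<Sum>l\<in>UNIV. u l *\<^sub>R Y l)"
  proof
    fix i
    have "X i \<in> span (range Y)" using assms(3) by (simp add: image_subset_iff)
    from span_range_family[OF this] show "\<exists>u. X i = (\<Sum>l\<in>UNIV. u l *\<^sub>R Y l)" .
  qed
  from choice[OF this] obtain b where b: "\<And>i. X i = (\<Sum>l\<in>UNIV. b i l *\<^sub>R Y l)" by blast
  have "\<forall>i. \<exists>u. Y i = (\<Sum>l\<in>UNIV. u l *\<^sub>R X l)"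
  proof
    fix i
    have "Y i \<in> span (range X)" using assms(4) by (simp add: image_subset_iff)
    from span_range_family[OF this] show "\<exists>u. Y i = (\<Sum>l\<in>UNIV. u l *\<^sub>R X l)" .
  qed
  from choice[OF this] obtain a where a: "\<And>i. Y i = (\<Sum>l\<in>UNIV. a i l *\<^sub>R X l)" by blast
  define B :: "real^'n^'n" where "B = (\<chi> i l. b i l)"
  define A :: "real^'n^'n" where "A = (\<chi> i l. a i l)"
  have "(B ** A) $ i $ k = mat 1 $ i $ k" for i k
  proof -
    have "(\<Sum>k\<in>UNIV. (B ** A) $ i $ k *\<^sub>R X k) = (\<Sum>k\<in>UNIV. \<Sum>l\<in>UNIV. (b i l * a l k) *\<^sub>R X k)"
      by (simp add: matrix_matrix_mult_def A_def B_def scaleR_sum_left)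
    also have "\<dots> = (\<Sum>l\<in>UNIV. b i l *\<^sub>R (\<Sum>k\<in>UNIV. a l k *\<^sub>R X k))"
      by (subst sum.swap) (simp add: scaleR_sum_right)
    also have "\<dots> = X i" by (simp add: a[symmetric] b[symmetric])
    also have "\<dots> = (\<Sum>k\<in>UNIV. mat 1 $ i $ k *\<^sub>R X k)"
      by (simp add: mat_def if_distrib[of "\<lambda>c. c *\<^sub>R _"] cong: if_cong)
    finally show ?thesis by (rule independent_family_coefficients[OF X])
  qed
  then have "B ** A = mat 1" by (simp add: vec_eq_iff)
  then have "invertible B"
    by (simp add: invertible_right_inverse) blast
  then show ?thesis using b by (intro exI[of _ B]) (simp add: B_def)
qed

lemma independent_family_spans:
  fixes X Y :: "'n::finite \<Rightarrow> 'a::real_vector"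
  assumes "inj X" "independent (range X)" "inj Y" "independent (range Y)" "range Y \<subseteq> span (range X)"
  shows "span (range Y) = span (range X)"
proof (intro equalityI)
  show "span (range Y) \<subseteq> span (range X)" using assms(5) by (simp add: span_minimal)
  have "x \<in> span (range Y)" if "x \<in> range X" for x
  proof (rule ccontr)
    assume x: "x \<notin> span (range Y)"
    then have "independent (insert x (range Y))" by (intro independent_insertI assms)
    moreover have "insert x (range Y) \<subseteq> span (range X)" using assms(5) span_base[OF that] by simp
    ultimately have "card (insert x (range Y)) \<le> card (range X)"
      using independent_span_bound[of "range X" "insert x (range Y)"] by simp
    moreover have "x \<notin> range Y" using x span_base[of x "range Y"] by blast
    ultimately show False using assms(1,3) by (simp add: card_image)
  qed
  then show "span (range X) \<subseteq> span (range Y)" by (intro span_minimal) auto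
qed

section \<open>The induced automorphism of the Lie algebra\<close>

theorem lemma1:
  fixes n :: nat
    and \<Omega> M :: "point set"
    and \<omega> :: "point \<Rightarrow> real"
    and L :: "(point \<Rightarrow> point) set"
    and X :: "'N::finite \<Rightarrow> point \<Rightarrow> point"
    and c :: "'N \<Rightarrow> 'N \<Rightarrow> 'N \<Rightarrow> real"
    and \<Gamma> :: "point \<Rightarrow> point"
    and Xh :: "'N \<Rightarrow> point \<Rightarrow> point"
  defines "M \<equiv> base_domain \<Omega>"
    and "L \<equiv> contact_generators n \<Omega> \<omega>"
    and "Xh \<equiv> (\<lambda>i. pullback_vf M \<Gamma> (X i))"
  assumes n: "n \<ge> 3"
    and Omega: "openin (Euclidean_space (n + 1)) \<Omega>"
    and omega: "smooth_fun_on (n + 1) \<Omega> \<omega>"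
    and lie_algebra: "vf_lie_algebra L"
    and basis: "inj X" "independent (range X)" "span (range X) = L"
    and structure_constants:
      "\<And>i j. commutator (X i) (X j) = (\<Sum>k\<in>UNIV. c i j k *\<^sub>R X k)"
    and symmetry: "contact_symmetry n \<Omega> \<omega> \<Gamma>"
  shows "(\<forall>i. Xh i \<in> L) \<and>
    (\<exists>\<phi>. (\<forall>i. \<phi> (X i) = Xh i) \<and> vf_lie_automorphism L \<phi>) \<and>
    (\<exists>b :: real^'N^'N. invertible b \<and> (\<forall>i. X i = (\<Sum>l\<in>UNIV. (b $ i $ l) *\<^sub>R Xh l))) \<and>
    (\<forall>i j. commutator (Xh i) (Xh j) = (\<Sum>k\<in>UNIV. c i j k *\<^sub>R Xh k))"
proof -
  interpret equation_symmetry n \<Omega> \<omega> \<Gamma>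
    by unfold_locales (fact n Omega omega symmetry)+
  let ?\<phi> = "pullback_vf M \<Gamma>"
  have vf: "vector_field_on M V" if "V \<in> L" for V
    using that by (simp add: L_def M_def contact_generators_def)
  have L: "subspace L" and brL: "\<And>V W. V \<in> L \<Longrightarrow> W \<in> L \<Longrightarrow> commutator V W \<in> L"
    using lie_algebra by (auto simp: vf_lie_algebra_def)
  have XL: "X i \<in> L" for i using span_base[of "X i" "range X"] basis(3) by simp
  have \<phi>L: "?\<phi> V \<in> L" if "V \<in> L" for V
    using pullback_contact_generators that by (simp add: L_def M_def)
  have add: "?\<phi> (V + W) = ?\<phi> V + ?\<phi> W" if "V \<in> L" "W \<in> L" for V W
    using pullback_vf_add vf that by (simp add: M_def)
  have scale: "?\<phi> (a *\<^sub>R V) = a *\<^sub>R ?\<phi> V" if "V \<in> L" for V a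
    using pullback_vf_scaleR vf that by (simp add: M_def)
  have bracket: "?\<phi> (commutator V W) = commutator (?\<phi> V) (?\<phi> W)" if "V \<in> L" "W \<in> L" for V W
    using pullback_vf_commutator vf that by (simp add: M_def)
  have inj: "inj_on ?\<phi> L"
    using pullback_vf_inject vf by (auto simp: M_def intro: inj_onI)
  \<comment> \<open>The pull-back is linear on \<open>L\<close> only; \<open>g\<close> is a linear map on all functions that agrees
    with it on \<open>L\<close>.\<close>
  obtain g where g: "linear g" "\<And>i. g (X i) = ?\<phi> (X i)"
    using linear_independent_extend[OF basis(2), of ?\<phi>] by blast
  have g_eq: "g V = ?\<phi> V" if "V \<in> L" for V
  proof -
    have "V \<in> span (range X)" using that basis(3) by simp
    then have "V \<in> L \<and> g V = ?\<phi> V"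
    proof (induction rule: span_induct_alt)
      case base
      show ?case using scale[of 0 0] subspace_0[OF L] linear_0[OF g(1)] by (simp add: zero_fun_def)
    next
      case (step a V W)
      then obtain i where V: "V = X i" by blast
      have aX: "a *\<^sub>R X i \<in> L" by (rule subspace_scale[OF L XL])
      show ?case
        unfolding V linear_add[OF g(1)] linear_scale[OF g(1)] g(2)
        using subspace_add[OF L aX] add[OF aX] scale[OF XL] step by metis
    qed
    then show ?thesis by simp
  qed
  have Xh: "Xh i = g (X i)" for i by (simp add: Xh_def g(2))
  have g_inj: "inj_on g (span (range X))"
    unfolding basis(3) using inj g_eq by (simp add: inj_on_def)
  have Xh_range: "range Xh = g ` range X" by (auto simp: Xh)
  have Xh_indep: "independent (range Xh)"
    unfolding Xh_range by (rule linear_independent_injective_image[OF g(1) basis(2) g_inj])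
  have Xh_inj: "inj Xh"
    using inj XL basis(1) by (auto simp: Xh_def inj_on_def)
  have XhL: "range Xh \<subseteq> L" using \<phi>L XL by (auto simp: Xh_def)
  have span: "span (range Xh) = L"
    using independent_family_spans[OF basis(1,2) Xh_inj Xh_indep] XhL basis(3) by simp
  have "?\<phi> ` L = g ` L" using g_eq by auto
  also have "\<dots> = L" using linear_span_image[OF g(1), of "range X"] basis(3) span Xh_range by simp
  finally have "bij_betw ?\<phi> L L" using inj by (simp add: bij_betw_def)
  then have automorphism: "vf_lie_automorphism L ?\<phi>"
    using add scale bracket by (simp add: vf_lie_automorphism_def)
  have basis_change: "\<exists>b :: real^'N^'N. invertible b \<and> (\<forall>i. X i = (\<Sum>l\<in>UNIV. (b $ i $ l) *\<^sub>R Xh l))"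
    by (rule change_of_basis_invertible[OF basis(1,2)]) (use XL XhL span basis(3) in auto)
  have brackets: "commutator (Xh i) (Xh j) = (\<Sum>k\<in>UNIV. c i j k *\<^sub>R Xh k)" for i j
  proof -
    have "commutator (Xh i) (Xh j) = g (commutator (X i) (X j))"
      using bracket[OF XL XL] g_eq[OF brL[OF XL XL]] by (simp add: Xh_def)
    then show ?thesis
      using g(1) by (simp add: structure_constants linear_sum linear_scale Xh)
  qed
  show ?thesis
  proof (intro conjI allI basis_change brackets)
    show "Xh i \<in> L" for i using XhL by blast
    show "\<exists>\<phi>. (\<forall>i. \<phi> (X i) = Xh i) \<and> vf_lie_automorphism L \<phi>"
      using automorphism by (intro exI[of _ ?\<phi>]) (simp add: Xh_def)
  qed
qed

end
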